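(* For every acyclically oriented graph $\vec H$ with $m_2(\vec H)>1/2$, there exists a constant $C=C(\vec H)$ such that if $p=p(n)\ge Cn^{-1/m_2(\vec H)}$, then asymptotically almost surely (i.e. with probability tending to $1$ as $n\to\infty$) $G(n,p)\to\vec H$.
   Context: An oriented graph is an orientation of a finite simple graph (each edge receives exactly one of its two directions); it is acyclically oriented (acyclic) if it contains no directed cycle. For a graph $G$ and an oriented graph $\vec H$, $G\to\vec H$ means that every orientation of $G$ contains a copy of $\vec H$, i.e. a (not necessarily induced) subdigraph isomorphic to $\vec H$. $G(n,p)$ is the binomial random graph on $n$ vertices, in which each edge of $K_n$ is present independently with probability $p$. For a graph $J$, $v(J)$ and $e(J)$ denote its numbers of vertices and edges. Let $\rho_2(J)=(e(J)-1)/(v(J)-2)$ if $v(J)\ge 3$, and let $\rho_2(K_1)=\rho_2(2K_1)=0$ and $\rho_2(K_2)=1/2$. The maximum $2$-density of a graph $H$ is $m_2(H)=\max\{\rho_2(J):J\subseteq H\}$, the maximum over subgraphs $J$ of $H$ with at least one vertex (possibly $J=H$). For an oriented graph $\vec H$ with underlying undirected graph $H$, $m_2(\vec H)=m_2(H)$. *)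

theory Defs
  imports
    "HOL-Probability.Probability"
    "Graph_Theory.Pair_Digraph"
    "Graph_Theory.Digraph_Component"
    "Graph_Theory.Digraph_Isomorphism"
begin

text \<open>
  As in the library, a finite simple graph is a symmetric loop-free digraph (locale
  \<^locale>\<open>pair_graph\<close>): an edge between u and v is represented by both arcs (u, v) and (v, u).
\<close>

definition orientation :: "'a pair_pre_digraph \<Rightarrow> 'a pair_pre_digraph \<Rightarrow> bool" where
  "orientation G D \<longleftrightarrow>
     pverts D = pverts G \<and> parcs D \<subseteq> parcs G \<and>
     (\<forall>(u, v) \<in> parcs G. ((u, v) \<in> parcs D) \<noteq> ((v, u) \<in> parcs D))"

definition oriented_graph :: "'a pair_pre_digraph \<Rightarrow> bool" where
  "oriented_graph D \<longleftrightarrow> (\<exists>G. pair_graph G \<and> orientation G D)"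

definition acyclically_oriented :: "'a pair_pre_digraph \<Rightarrow> bool" where
  "acyclically_oriented D \<longleftrightarrow>
     oriented_graph D \<and> \<not> (\<exists>c. pre_digraph.cycle (with_proj D) c)"

definition contains_copy :: "'a pair_pre_digraph \<Rightarrow> 'b pair_pre_digraph \<Rightarrow> bool" where
  "contains_copy D H \<longleftrightarrow>
     (\<exists>D'. subgraph (with_proj D') (with_proj D) \<and> digraph_iso (with_proj H) (with_proj D'))"

definition arrows :: "'a pair_pre_digraph \<Rightarrow> 'b pair_pre_digraph \<Rightarrow> bool" where
  "arrows G H \<longleftrightarrow> (\<forall>D. orientation G D \<longrightarrow> contains_copy D H)"

definition num_verts :: "'a pair_pre_digraph \<Rightarrow> nat" where
  "num_verts J = card (pverts J)"

text \<open>The two arcs of an undirected edge are counted once.\<close>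

definition num_edges :: "'a pair_pre_digraph \<Rightarrow> nat" where
  "num_edges J = card ((\<lambda>(u, v). {u, v}) ` parcs J)"

definition rho2 :: "'a pair_pre_digraph \<Rightarrow> real" where
  "rho2 J =
     (if num_verts J \<ge> 3 then (real (num_edges J) - 1) / (real (num_verts J) - 2)
      else if num_verts J = 2 \<and> num_edges J = 1 then 1 / 2
      else 0)"

definition m2 :: "'a pair_pre_digraph \<Rightarrow> real" where
  "m2 G = Max {rho2 J | J.
     pair_graph J \<and> subgraph (with_proj J) (with_proj G) \<and> pverts J \<noteq> {}}"

definition m2_oriented :: "'a pair_pre_digraph \<Rightarrow> real" where
  "m2_oriented D = m2 (mk_symmetric (with_proj D))"

text \<open>The binomial random graph on the vertex set \<open>{..<n}\<close>.\<close>

definition gnp :: "nat \<Rightarrow> real \<Rightarrow> nat pair_pre_digraph pmf" where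
  "gnp n p =
     map_pmf
       (\<lambda>f. \<lparr> pverts = {..<n}, parcs = {(u, v). u < n \<and> v < n \<and> u \<noteq> v \<and> f {u, v}} \<rparr>)
       (Pi_pmf {e. e \<subseteq> {..<n} \<and> card e = 2} False (\<lambda>_. bernoulli_pmf p))"

end

theory Submission
  imports Defs
begin

text \<open>
  The proof follows Nenadov and Steger. Consider the hypergraph whose vertices are the arcs on
  \<open>{..<n}\<close> and whose edges are the copies of \<open>H\<close>. An orientation without a copy of \<open>H\<close> is an independent
  set, so the container theorem (proved along the lines of Nenadov and Pham) provides a fingerprint
  of \<open>O(n ^ 2 * q)\<close> arcs, where \<open>q = n powr (- 1 / m2)\<close>, which determines a set of arcs containing the
  orientation and only few copies of \<open>H\<close>. As every tournament on \<open>2 ^ h\<close> vertices contains every acyclic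
  oriented graph on \<open>h\<close> vertices, averaging shows that a container with few copies leaves a positive
  proportion of all pairs uncovered in both directions. The random graph has to contain the
  fingerprint and avoid all these pairs, and for \<open>p \<ge> C * q\<close> the union bound over fingerprints
  succeeds. The maximum 2-density enters through the codegrees: a set of \<open>j\<close> arcs spanning \<open>v\<close> vertices
  lies in \<open>O(n ^ (h - v))\<close> copies, and \<open>n ^ (2 - v) \<le> q ^ (j - 1)\<close>.
\<close>

section \<open>Hypergraph containers\<close>

text \<open>A plain union bound over containers loses a logarithm: there are roughly exp(k log(1/q))
  sets of k = O(n^2 q) arcs, and at p = C q a gain of exp(-c p n^2) cannot absorb this. The loss
  disappears because a fingerprint S is part of the orientation, so its edges must occur in the
  random graph, which contributes a factor p^|S|. An orientation has no two opposite arcs, so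
  distinct arcs of S use distinct edges.

  Arcs rather than edges serve as vertices since an independent set has to record directions. A
  container may hold both arcs of a pair; only a pair with neither arc in it constrains the graph,
  because every edge present gets some direction.

  In the container algorithm the danger is that shortened edges pile up on a few sets, which would
  destroy the codegree bound for the next round. Sets whose codegree reaches a limit are therefore
  closed to further edges.

  The assumption m2 > 1/2 makes n^2 q a positive power of n, so the fingerprint size does not
  degenerate and the final error bound tends to 0.\<close>

text \<open>
  The second clause makes the container a function of the fingerprint alone: for
  \<open>I' = fst (f I)\<close> it says \<open>f (fst (f I)) = f I\<close>.
\<close>

definition fingerprinting :: "('v set \<Rightarrow> 'v set \<times> 'b) \<Rightarrow> bool" where
  "fingerprinting f \<longleftrightarrow>
     (\<forall>I. fst (f I) \<subseteq> I) \<and> (\<forall>I I'. fst (f I) \<subseteq> I' \<longrightarrow> I' \<subseteq> I \<longrightarrow> f I' = f I)"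

text \<open>
  Hypergraphs are families \<open>r\<close> of vertex sets indexed by a finite set \<open>A\<close>, so that edges may be repeated.
\<close>

definition codegree :: "'i set \<Rightarrow> ('i \<Rightarrow> 'v set) \<Rightarrow> 'v set \<Rightarrow> nat" where
  "codegree A r \<sigma> = card {e \<in> A. \<sigma> \<subseteq> r e}"

definition stable :: "'i set \<Rightarrow> ('i \<Rightarrow> 'v set) \<Rightarrow> 'v set \<Rightarrow> bool" where
  "stable A r I \<longleftrightarrow> (\<forall>e\<in>A. \<not> r e \<subseteq> I)"

definition uniform_on :: "'v set \<Rightarrow> nat \<Rightarrow> 'i set \<Rightarrow> ('i \<Rightarrow> 'v set) \<Rightarrow> bool" where
  "uniform_on V s A r \<longleftrightarrow> finite A \<and> (\<forall>e\<in>A. r e \<subseteq> V \<and> card (r e) = s)"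

text \<open>
  \<open>E\<close> only sets the scale for the number of edges; it drops by a factor \<open>p\<close> with each reduction of
  the uniformity. Similarly \<open>N\<close> is an upper bound for the number of vertices.
\<close>

definition codegree_bounded :: "real \<Rightarrow> real \<Rightarrow> real \<Rightarrow> real \<Rightarrow> 'i set \<Rightarrow> ('i \<Rightarrow> 'v set) \<Rightarrow> bool" where
  "codegree_bounded p E N b A r \<longleftrightarrow>
     (\<forall>\<sigma>. finite \<sigma> \<longrightarrow> \<sigma> \<noteq> {} \<longrightarrow> real (codegree A r \<sigma>) \<le> b * p ^ (card \<sigma> - 1) * E / N)"

text \<open>The fingerprint law is imposed on every set and the bounds only on stable ones, so that
  maps compose without a stability side condition.\<close>

definition container_map :: "'i set \<Rightarrow> ('i \<Rightarrow> 'v set) \<Rightarrow> 'v set \<Rightarrow> real \<Rightarrow> ('v set \<Rightarrow> bool) \<Rightarrow>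
    ('v set \<Rightarrow> 'v set \<times> 'v set) \<Rightarrow> bool" where
  "container_map A r V k Q f \<longleftrightarrow> fingerprinting f \<and>
     (\<forall>I\<subseteq>V. stable A r I \<longrightarrow>
       real (card (fst (f I))) \<le> k \<and> I \<subseteq> snd (f I) \<and> snd (f I) \<subseteq> V \<and> Q (snd (f I)))"

lemma container_mapD:
  assumes "container_map A r V k Q f"
  shows "fingerprinting f"
    and "\<And>I. I \<subseteq> V \<Longrightarrow> stable A r I \<Longrightarrow>
       real (card (fst (f I))) \<le> k \<and> I \<subseteq> snd (f I) \<and> snd (f I) \<subseteq> V \<and> Q (snd (f I))"
  using assms unfolding container_map_def by blast+

lemma container_map_mono:
  assumes "container_map A r V k Q f" and "\<And>C. Q C \<Longrightarrow> Q' C"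
  shows "container_map A r V k Q' f"
  using assms(1) assms(2)[of "snd (f _)"] unfolding container_map_def by metis

lemma fingerprinting_const: "fingerprinting (\<lambda>_. ({}, C))"
  by (simp add: fingerprinting_def)

text \<open>Replay argument: the union contains the fingerprint of the first stage, so
  \<open>f\<close> returns the same \<open>c\<close>. This fixes the branch and the second stage
  \<open>g c\<close>, whose fingerprint is contained as well. The test \<open>Q\<close> may look at
  \<open>c\<close> but not at \<open>I\<close>.\<close>

lemma fingerprinting_bind:
  assumes f: "fingerprinting f"
    and g: "\<And>c. Q c \<Longrightarrow> fingerprinting (g c)"
  shows "fingerprinting (\<lambda>I. let (S, c) = f I in
           if Q c then (S \<union> fst (g c I), h c (snd (g c I))) else (S, k c))"
    (is "fingerprinting ?F")
proof -
  have 1: "fst (?F I) \<subseteq> I" for I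
  proof -
    obtain S c where fI: "f I = (S, c)" by fastforce
    have "S \<subseteq> I" using f fI unfolding fingerprinting_def by (metis fst_conv)
    moreover have "fst (g c I) \<subseteq> I" if "Q c" using g[OF that] unfolding fingerprinting_def by blast
    ultimately show ?thesis using fI by simp
  qed
  have 2: "?F I' = ?F I" if "fst (?F I) \<subseteq> I'" "I' \<subseteq> I" for I I'
  proof -
    obtain S c where fI: "f I = (S, c)" by fastforce
    have "S \<subseteq> I'" using that(1) fI by (auto split: if_splits)
    then have fI': "f I' = (S, c)" using f that(2) fI unfolding fingerprinting_def by (metis fst_conv)
    show ?thesis
    proof (cases "Q c")
      case True
      then have "fst (g c I) \<subseteq> I'" using that(1) fI by auto
      then have "g c I' = g c I" using g[OF True] that(2) unfolding fingerprinting_def by blast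
      then show ?thesis using fI fI' by simp
    qed (simp add: fI fI')
  qed
  from 1 2 show ?thesis unfolding fingerprinting_def by blast
qed

lemma codegree_mono: "finite A \<Longrightarrow> A' \<subseteq> A \<Longrightarrow> codegree A' r \<sigma> \<le> codegree A r \<sigma>"
  unfolding codegree_def by (intro card_mono) auto

lemma sum_codegree:
  assumes "finite A" "finite T"
  shows "(\<Sum>\<sigma>\<in>T. codegree A r \<sigma>) = (\<Sum>e\<in>A. card {\<sigma>\<in>T. \<sigma> \<subseteq> r e})"
proof -
  have "(\<Sum>\<sigma>\<in>T. codegree A r \<sigma>) = (\<Sum>\<sigma>\<in>T. \<Sum>e\<in>A. if \<sigma> \<subseteq> r e then 1 else 0)"
    using assms by (simp add: codegree_def sum.If_cases Int_def)
  also have "\<dots> = (\<Sum>e\<in>A. \<Sum>\<sigma>\<in>T. if \<sigma> \<subseteq> r e then 1 else 0)" by (rule sum.swap)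
  also have "\<dots> = (\<Sum>e\<in>A. card {\<sigma>\<in>T. \<sigma> \<subseteq> r e})"
    using assms by (simp add: sum.If_cases Int_def)
  finally show ?thesis .
qed

section \<open>One round: lowering the uniformity by one\<close>

text \<open>\<open>to_nat\<close> supplies a linear order on the vertices; a least element stays
  least in every smaller set that still contains it.\<close>

definition first :: "'v::countable set \<Rightarrow> 'v" where
  "first X = (ARG_MIN to_nat v. v \<in> X)"

lemma first_in: "X \<noteq> {} \<Longrightarrow> first X \<in> X"
  unfolding first_def using arg_min_natI[of "\<lambda>v. v \<in> X"] by blast

lemma first_subset:
  assumes "first X \<in> Y" "Y \<subseteq> X"
  shows "first Y = first X"
proof -
  have "first Y \<in> Y" using assms first_in by blast
  then have "to_nat (first X) \<le> to_nat (first Y)"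
    unfolding first_def[of X] using assms(2) by (intro arg_min_nat_le) auto
  moreover have "to_nat (first Y) \<le> to_nat (first X)"
    unfolding first_def[of Y] using assms(1) by (intro arg_min_nat_le) auto
  ultimately show ?thesis by simp
qed

text \<open>
  One reduction of the uniformity from \<open>Suc s\<close> to \<open>s\<close>. A state \<open>(S, A', r')\<close> consists of the vertices \<open>S\<close>
  of the independent set picked so far and the lower hypergraph \<open>(A', r')\<close> formed by the edges through
  \<open>S\<close>, each with the vertex of \<open>S\<close> through which it was used removed. Any vertex of large available
  degree may be picked, provided that the choice does not change when the independent set shrinks to a
  smaller set still containing the choice; \<open>first\<close> has this property.
\<close>

locale container_round =
  fixes A :: "'i set" and r :: "'i \<Rightarrow> 'v::countable set" and V :: "'v set"
    and s :: nat and N p E a b :: real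
  assumes finV: "finite V" and cardV: "real (card V) \<le> N"
    and p0: "0 < p" and pb: "p \<le> a / (8 * b)" and pN: "1 \<le> p * N"
    and E0: "0 < E" and a0: "0 < a" and b0: "0 < b"
    and unif: "uniform_on V (Suc s) A r"
    and many: "a * E \<le> real (card A)"
    and bdd: "codegree_bounded p E N b A r"
begin

definition cap :: real where "cap = 2 ^ (s + 3) * b\<^sup>2 / a"

text \<open>Light vertices together carry at most \<open>N * thr\<close>, half of the
  \<open>a * E / 2\<close> available edges, while \<open>p * N\<close> heavy picks collect at least
  \<open>a / 4 * (p * E)\<close> edges for the next round.\<close>

definition thr :: real where "thr = a * E / (4 * N)"

text \<open>The limit equals \<open>cap * p ^ (card \<sigma> - 1) * (p * E) / N\<close>, which is
  the codegree condition of the lower hypergraph at its new scale \<open>p * E\<close>.\<close>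

definition saturated :: "'i set \<Rightarrow> ('i \<Rightarrow> 'v set) \<Rightarrow> 'v set \<Rightarrow> bool" where
  "saturated A' r' \<sigma> \<longleftrightarrow> \<sigma> \<noteq> {} \<and> cap * p ^ card \<sigma> * E / N \<le> real (codegree A' r' \<sigma>)"

text \<open>Excluding the edges that meet \<open>S\<close> means that each edge is shortened at most
  once, so the lower hypergraph can keep the indices of the old one.\<close>

fun avail :: "'v set \<times> 'i set \<times> ('i \<Rightarrow> 'v set) \<Rightarrow> 'i set" where
  "avail (S, A', r') = {e \<in> A. r e \<inter> S = {} \<and> \<not> (\<exists>\<sigma>\<subseteq>r e. saturated A' r' \<sigma>)}"

definition heavy :: "'v set \<times> 'i set \<times> ('i \<Rightarrow> 'v set) \<Rightarrow> 'v set" where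
  "heavy st = {v. thr \<le> real (codegree (avail st) r {v})}"

fun pick :: "'v \<Rightarrow> 'v set \<times> 'i set \<times> ('i \<Rightarrow> 'v set) \<Rightarrow> 'v set \<times> 'i set \<times> ('i \<Rightarrow> 'v set)" where
  "pick v (S, A', r') = (let D = {e \<in> avail (S, A', r'). v \<in> r e} in
     (insert v S, A' \<union> D, \<lambda>e. if e \<in> D then r e - {v} else r' e))"

definition step :: "'v set \<Rightarrow> 'v set \<times> 'i set \<times> ('i \<Rightarrow> 'v set) \<Rightarrow> 'v set \<times> 'i set \<times> ('i \<Rightarrow> 'v set)" where
  "step I st = (if I \<inter> heavy st = {} then st else pick (first (I \<inter> heavy st)) st)"

definition run :: "nat \<Rightarrow> 'v set \<Rightarrow> 'v set \<times> 'i set \<times> ('i \<Rightarrow> 'v set)" where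
  "run t I = (step I ^^ t) ({}, {}, r)"

lemma run_0: "run 0 I = ({}, {}, r)"
  and run_Suc: "run (Suc t) I = step I (run t I)"
  by (simp_all add: run_def)

lemma fst_pick: "fst (pick v st) = insert v (fst st)"
  by (cases st) (simp add: Let_def)

lemma fst_step: "fst st \<subseteq> fst (step I st)"
  by (auto simp: step_def fst_pick)

text \<open>The two runs stay in lockstep: \<open>heavy\<close> depends on the state alone, a
  smaller set cannot gain heavy vertices, and the chosen vertex lies in \<open>I'\<close> because it
  ends up in the fingerprint.\<close>

lemma fingerprinting_run: "fingerprinting (run t)"
proof -
  have 1: "fst (run t I) \<subseteq> I" for t I
  proof (induction t)
    case (Suc t)
    have "first (I \<inter> heavy (run t I)) \<in> I" if "I \<inter> heavy (run t I) \<noteq> {}"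
      using first_in[OF that] by blast
    with Suc show ?case by (auto simp: run_Suc step_def fst_pick)
  qed (simp add: run_0)
  have 2: "run t I' = run t I" if "fst (run t I) \<subseteq> I'" "I' \<subseteq> I" for t I I'
    using that(1)
  proof (induction t)
    case (Suc t)
    let ?st = "run t I"
    have *: "fst (step I ?st) \<subseteq> I'" using Suc.prems by (simp add: run_Suc)
    then have "fst ?st \<subseteq> I'" using fst_step by blast
    then have eq: "run t I' = ?st" by (rule Suc.IH)
    have "step I' ?st = step I ?st"
    proof (cases "I \<inter> heavy ?st = {}")
      case True
      then have "I' \<inter> heavy ?st = {}" using that(2) by blast
      with True show ?thesis by (simp add: step_def)
    next
      case False
      then have "first (I \<inter> heavy ?st) \<in> I' \<inter> heavy ?st"
        using * first_in[OF False] by (simp add: step_def fst_pick)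
      moreover from this have "first (I' \<inter> heavy ?st) = first (I \<inter> heavy ?st)"
        using that(2) by (intro first_subset) auto
      ultimately show ?thesis using False by (auto simp: step_def)
    qed
    then show ?case by (simp add: run_Suc eq)
  qed (simp add: run_0)
  from 1 2 show ?thesis unfolding fingerprinting_def by blast
qed

lemma finA: "finite A" using unif by (simp add: uniform_on_def)

lemma N0: "0 < N" using pN p0 by (smt (verit) mult_nonneg_nonpos)

lemma thr0: "0 < thr" using a0 E0 N0 by (simp add: thr_def)

lemma cap0: "0 < cap" using a0 b0 by (simp add: cap_def)

text \<open>The lower bound on \<open>card A'\<close> makes the next hypergraph dense; the upper
  bound limits the number of saturated sets in \<open>card_avail\<close>.\<close>

fun invariant :: "'v set \<times> 'i set \<times> ('i \<Rightarrow> 'v set) \<Rightarrow> bool" where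
  "invariant (S, A', r') \<longleftrightarrow> finite S \<and> A' \<subseteq> A \<and>
     (\<forall>e\<in>A'. \<exists>v\<in>S. v \<in> r e \<and> r' e = r e - {v}) \<and>
     real (card S) * thr \<le> real (card A') \<and>
     real (card A') \<le> real (card S) * (b * E / N) \<and>
     codegree_bounded p (p * E) N (cap + b) A' r'"

lemma avail_subset: "avail st \<subseteq> A"
  by (cases st) auto

lemma codegree_single_le: "real (codegree A r {v}) \<le> b * E / N"
  using bdd[unfolded codegree_bounded_def, rule_format, of "{v}"] by simp

lemma heavy_disjoint: "fst st \<inter> heavy st = {}"
proof (cases st)
  case (fields S A' r')
  have "v \<notin> heavy st" if "v \<in> S" for v
  proof -
    have "{e \<in> avail st. {v} \<subseteq> r e} = {}" using that fields by auto
    then have "codegree (avail st) r {v} = 0" unfolding codegree_def by (metis card.empty)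
    then show ?thesis using thr0 by (simp add: heavy_def)
  qed
  then show ?thesis using fields by auto
qed

text \<open>A set gains edges only while unsaturated, so its codegree was below the
  \<open>cap\<close> limit before the pick. The new edges all contain
  \<open>insert v \<sigma>\<close>, hence number at most
  \<open>b * p ^ card \<sigma> * E / N\<close>; this overshoot is the \<open>b\<close> in
  \<open>cap + b\<close>.\<close>

lemma invariant_pick:
  assumes "invariant st" "v \<in> heavy st"
  shows "invariant (pick v st)"
proof (cases st)
  case (fields S A' r')
  define D where "D = {e \<in> avail st. v \<in> r e}"
  define r'' where "r'' = (\<lambda>e. if e \<in> D then r e - {v} else r' e)"
  have pick: "pick v st = (insert v S, A' \<union> D, r'')"
    by (simp add: fields D_def r''_def Let_def)
  have i: "finite S" "A' \<subseteq> A" "\<forall>e\<in>A'. \<exists>v\<in>S. v \<in> r e \<and> r' e = r e - {v}"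
    "real (card S) * thr \<le> real (card A')" "real (card A') \<le> real (card S) * (b * E / N)"
    "codegree_bounded p (p * E) N (cap + b) A' r'"
    using assms(1)[unfolded fields invariant.simps] by blast+
  have vS: "v \<notin> S" using heavy_disjoint[of st] assms(2) fields by auto
  have DA: "D \<subseteq> A" using avail_subset D_def by blast
  have disj: "A' \<inter> D = {}" using i(3) by (auto simp: D_def fields)
  have finD: "finite D" "finite A'" using DA i(2) finA finite_subset by blast+
  have cardD: "card (A' \<union> D) = card A' + card D"
    using finD disj by (simp add: card_Un_disjoint)
  have D: "card D = codegree (avail st) r {v}" by (simp add: D_def codegree_def)
  have Dlow: "thr \<le> real (card D)" using assms(2) D by (simp add: heavy_def)
  have Dup: "real (card D) \<le> b * E / N"
    using codegree_mono[OF finA avail_subset, of st r "{v}"] codegree_single_le[of v] D by simp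
  have eqA: "r'' e = r' e" if "e \<in> A'" for e using that disj by (auto simp: r''_def)
  have eqD: "r'' e = r e - {v}" if "e \<in> D" for e using that by (simp add: r''_def)
  have "codegree_bounded p (p * E) N (cap + b) (A' \<union> D) r''"
    unfolding codegree_bounded_def
  proof (intro allI impI)
    fix \<sigma> :: "'v set" assume \<sigma>: "finite \<sigma>" "\<sigma> \<noteq> {}"
    have "{e \<in> A' \<union> D. \<sigma> \<subseteq> r'' e} = {e \<in> A'. \<sigma> \<subseteq> r' e} \<union> {e \<in> D. \<sigma> \<subseteq> r e - {v}}"
      using eqA eqD by auto
    then have split: "codegree (A' \<union> D) r'' \<sigma> \<le> codegree A' r' \<sigma> + card {e \<in> D. \<sigma> \<subseteq> r e - {v}}"
      unfolding codegree_def by (simp only: card_Un_le)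
    show "real (codegree (A' \<union> D) r'' \<sigma>) \<le> (cap + b) * p ^ (card \<sigma> - 1) * (p * E) / N"
    proof (cases "{e \<in> D. \<sigma> \<subseteq> r e - {v}} = {}")
      case True
      then have "codegree (A' \<union> D) r'' \<sigma> \<le> codegree A' r' \<sigma>" using split by (simp only: True card.empty)
      moreover have "real (codegree A' r' \<sigma>) \<le> (cap + b) * p ^ (card \<sigma> - 1) * (p * E) / N"
        using i(6) \<sigma> unfolding codegree_bounded_def by blast
      ultimately show ?thesis by linarith
    next
      case False
      then obtain e where e: "e \<in> D" "\<sigma> \<subseteq> r e - {v}" by blast
      then have "\<not> saturated A' r' \<sigma>" by (auto simp: D_def fields)
      then have lt: "real (codegree A' r' \<sigma>) < cap * p ^ card \<sigma> * E / N"
        using \<sigma> by (auto simp: saturated_def)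
      have "v \<notin> \<sigma>" using e by blast
      then have c: "card (insert v \<sigma>) = Suc (card \<sigma>)" using \<sigma> by simp
      have "card {e \<in> D. \<sigma> \<subseteq> r e - {v}} \<le> codegree A r (insert v \<sigma>)"
        unfolding codegree_def using DA finA by (intro card_mono) (auto simp: D_def)
      also have "real (codegree A r (insert v \<sigma>)) \<le> b * p ^ card \<sigma> * E / N"
        using bdd[unfolded codegree_bounded_def, rule_format, of "insert v \<sigma>"] \<sigma> c by simp
      finally have "real (codegree (A' \<union> D) r'' \<sigma>) \<le> cap * p ^ card \<sigma> * E / N + b * p ^ card \<sigma> * E / N"
        using split lt by linarith
      moreover have "p ^ card \<sigma> = p ^ (card \<sigma> - 1) * p"
        using \<sigma> by (metis Suc_diff_1 card_gt_0_iff power_Suc2)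
      ultimately show ?thesis by (simp add: algebra_simps add_divide_distrib)
    qed
  qed
  moreover have "\<forall>e\<in>A' \<union> D. \<exists>w\<in>insert v S. w \<in> r e \<and> r'' e = r e - {w}"
    using i(3) eqA eqD by (auto simp: D_def)
  moreover have "real (card (insert v S)) = real (card S) + 1" using vS i(1) by simp
  ultimately show ?thesis
    using i(1,2,4,5) DA Dlow Dup cardD unfolding pick by (auto simp: algebra_simps add_divide_distrib)
qed

lemma invariant_run: "invariant (run t I)"
proof (induction t)
  case 0
  then show ?case using p0 E0 N0 b0 cap0 by (simp add: run_0 codegree_bounded_def codegree_def)
next
  case (Suc t)
  have "first (I \<inter> heavy (run t I)) \<in> heavy (run t I)" if "I \<inter> heavy (run t I) \<noteq> {}"
    using first_in[OF that] by blast
  then show ?case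
    using invariant_pick[OF Suc] Suc by (simp add: run_Suc step_def)
qed

text \<open>An idle step leaves the state unchanged, so the run remains idle from then on; otherwise
  each step adds a new vertex, since \<open>heavy\<close> is disjoint from the current
  \<open>S\<close>.\<close>

lemma card_run: "card (fst (run t I)) \<le> t"
  and card_run_less: "card (fst (run t I)) < t \<Longrightarrow> I \<inter> heavy (run t I) = {}"
proof -
  have "card (fst (run t I)) \<le> t \<and> (card (fst (run t I)) = t \<or> I \<inter> heavy (run t I) = {})"
  proof (induction t)
    case (Suc t)
    show ?case
    proof (cases "I \<inter> heavy (run t I) = {}")
      case True
      then show ?thesis using Suc by (auto simp: run_Suc step_def)
    next
      case False
      have "finite (fst (run t I))" using invariant_run[of t I] by (cases "run t I") auto
      moreover have "first (I \<inter> heavy (run t I)) \<notin> fst (run t I)"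
        using first_in[OF False] heavy_disjoint by blast
      ultimately show ?thesis using Suc False by (auto simp: run_Suc step_def fst_pick)
    qed
  qed (simp add: run_0)
  then show "card (fst (run t I)) \<le> t" "card (fst (run t I)) < t \<Longrightarrow> I \<inter> heavy (run t I) = {}"
    by auto
qed

text \<open>
  Few edges are lost to saturated sets: the codegrees of saturated sets in \<open>(A', r')\<close> sum to at most
  \<open>2 ^ s * card A'\<close>, so there are few of them, and \<open>cap\<close> is chosen to compensate their codegrees in \<open>(A, r)\<close>.
\<close>

lemma card_avail:
  assumes "invariant (S, A', r')" and cS: "real (card S) \<le> 2 * p * N"
  shows "a * E / 2 \<le> real (card (avail (S, A', r')))"
proof -
  have i: "finite S" "A' \<subseteq> A" "\<forall>e\<in>A'. \<exists>v\<in>S. v \<in> r e \<and> r' e = r e - {v}"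
    "real (card A') \<le> real (card S) * (b * E / N)"
    using assms(1)[unfolded invariant.simps] by blast+
  have r: "r e \<subseteq> V" "card (r e) = Suc s" "finite (r e)" if "e \<in> A" for e
    using unif that finV finite_subset unfolding uniform_on_def by blast+
  have r': "r' e \<subseteq> V" "card (r' e) = s" "finite (r' e)" if e: "e \<in> A'" for e
  proof -
    obtain v where v: "v \<in> r e" "r' e = r e - {v}" using i(3) e by blast
    have "e \<in> A" using e i(2) by blast
    from r[OF this] v show "r' e \<subseteq> V" "card (r' e) = s" "finite (r' e)" by auto
  qed
  have finA': "finite A'" using i(2) finA finite_subset by blast
  have cA': "real (card A') \<le> 2 * p * b * E"
  proof -
    have "real (card S) * (b * E / N) \<le> 2 * p * N * (b * E / N)"
      using cS b0 E0 N0 by (intro mult_right_mono) auto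
    then show ?thesis using i(4) N0 by simp
  qed
  define X where "X = {e \<in> A. r e \<inter> S \<noteq> {}}"
  define Sat where "Sat = {\<sigma>. \<sigma> \<subseteq> V \<and> saturated A' r' \<sigma>}"
  define Y where "Y = {e \<in> A. \<exists>\<sigma>\<in>Sat. \<sigma> \<subseteq> r e}"
  have finSat: "finite Sat" unfolding Sat_def using finV by auto
  have "A \<subseteq> avail (S, A', r') \<union> X \<union> Y"
    using r(1) by (fastforce simp: X_def Y_def Sat_def)
  then have "card A \<le> card (avail (S, A', r') \<union> X \<union> Y)"
    using finA finite_subset[OF avail_subset finA] by (intro card_mono) (auto simp: X_def Y_def simp del: avail.simps)
  also have "\<dots> \<le> card (avail (S, A', r')) + card X + card Y"
    by (meson card_Un_le add_le_mono1 order_trans)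
  finally have le: "card A \<le> card (avail (S, A', r')) + card X + card Y" .
  have "real (card X) \<le> a * E / 4"
  proof -
    have "X = (\<Union>v\<in>S. {e \<in> A. {v} \<subseteq> r e})" by (auto simp: X_def)
    then have "card X \<le> (\<Sum>v\<in>S. codegree A r {v})"
      unfolding codegree_def using i(1) by (simp add: card_UN_le)
    then have "real (card X) \<le> (\<Sum>v\<in>S. real (codegree A r {v}))" by (metis of_nat_le_iff of_nat_sum)
    also have "\<dots> \<le> (\<Sum>v\<in>S. b * E / N)" by (intro sum_mono codegree_single_le)
    also have "\<dots> = real (card S) * (b * E / N)" by simp
    also have "\<dots> \<le> 2 * p * N * (b * E / N)"
      using cS b0 E0 N0 by (intro mult_right_mono) auto
    also have "\<dots> = 2 * p * b * E" using N0 by simp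
    \<comment> \<open>The 8 in the bound \<open>pb\<close> is chosen so that edges meeting
      \<open>S\<close> cost at most a quarter of \<open>a * E\<close>.\<close>
    also have "\<dots> \<le> 2 * (a / (8 * b)) * b * E"
      using pb b0 E0 by (intro mult_right_mono mult_left_mono) auto
    also have "\<dots> = a * E / 4" using b0 by simp
    finally show ?thesis .
  qed
  moreover have "real (card Y) \<le> a * E / 4"
  proof -
    have "Y = (\<Union>\<sigma>\<in>Sat. {e \<in> A. \<sigma> \<subseteq> r e})" by (auto simp: Y_def)
    then have "card Y \<le> (\<Sum>\<sigma>\<in>Sat. codegree A r \<sigma>)"
      unfolding codegree_def using finSat by (simp add: card_UN_le)
    then have "real (card Y) \<le> (\<Sum>\<sigma>\<in>Sat. real (codegree A r \<sigma>))" by (metis of_nat_le_iff of_nat_sum)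
    also have "\<dots> \<le> (\<Sum>\<sigma>\<in>Sat. b / (cap * p) * real (codegree A' r' \<sigma>))"
    proof (intro sum_mono)
      fix \<sigma> assume \<sigma>: "\<sigma> \<in> Sat"
      then have "finite \<sigma>" "\<sigma> \<noteq> {}" and sat: "cap * p ^ card \<sigma> * E / N \<le> real (codegree A' r' \<sigma>)"
        using finV finite_subset by (auto simp: Sat_def saturated_def)
      then have "real (codegree A r \<sigma>) \<le> b * p ^ (card \<sigma> - 1) * E / N"
        using bdd unfolding codegree_bounded_def by blast
      also have "\<dots> = b / (cap * p) * (cap * (p ^ (card \<sigma> - 1) * p) * E / N)"
        using cap0 p0 by simp
      also have "p ^ (card \<sigma> - 1) * p = p ^ card \<sigma>"
        using \<open>finite \<sigma>\<close> \<open>\<sigma> \<noteq> {}\<close> by (metis Suc_diff_1 card_gt_0_iff power_Suc2)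
      also have "b / (cap * p) * (cap * p ^ card \<sigma> * E / N) \<le> b / (cap * p) * real (codegree A' r' \<sigma>)"
        using sat b0 cap0 p0 by (intro mult_left_mono) auto
      finally show "real (codegree A r \<sigma>) \<le> b / (cap * p) * real (codegree A' r' \<sigma>)" .
    qed
    also have "\<dots> = b / (cap * p) * real (\<Sum>\<sigma>\<in>Sat. codegree A' r' \<sigma>)"
      by (simp add: sum_distrib_left)
    also have "\<dots> \<le> b / (cap * p) * (real (card A') * 2 ^ s)"
    proof (intro mult_left_mono)
      have "(\<Sum>\<sigma>\<in>Sat. codegree A' r' \<sigma>) = (\<Sum>e\<in>A'. card {\<sigma>\<in>Sat. \<sigma> \<subseteq> r' e})"
        by (rule sum_codegree[OF finA' finSat])
      also have "\<dots> \<le> (\<Sum>e\<in>A'. 2 ^ s)"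
      proof (intro sum_mono)
        fix e assume e: "e \<in> A'"
        have "card {\<sigma>\<in>Sat. \<sigma> \<subseteq> r' e} \<le> card (Pow (r' e))"
          using r'(3)[OF e] by (intro card_mono) auto
        then show "card {\<sigma>\<in>Sat. \<sigma> \<subseteq> r' e} \<le> 2 ^ s" using r'(2,3)[OF e] by (simp add: card_Pow)
      qed
      finally have "(\<Sum>\<sigma>\<in>Sat. codegree A' r' \<sigma>) \<le> card A' * 2 ^ s" by simp
      then show "real (\<Sum>\<sigma>\<in>Sat. codegree A' r' \<sigma>) \<le> real (card A') * 2 ^ s"
        by (metis of_nat_le_iff of_nat_mult of_nat_numeral of_nat_power)
    qed (use b0 cap0 p0 in auto)
    also have "\<dots> \<le> b / (cap * p) * ((2 * p * b * E) * 2 ^ s)"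
    proof (rule mult_left_mono)
      show "real (card A') * 2 ^ s \<le> (2 * p * b * E) * 2 ^ s" using cA' by (rule mult_right_mono) simp
      show "0 \<le> b / (cap * p)" using b0 cap0 p0 by simp
    qed
    also have "\<dots> = (2 ^ (s + 1) * b\<^sup>2 / cap) * E"
      using p0 by (simp add: power2_eq_square)
    also have "\<dots> = a * E / 4"
      using b0 a0 by (simp add: cap_def power_add)
    finally show ?thesis .
  qed
  ultimately show ?thesis using le many by linarith
qed

text \<open>Averaging of degrees over the available edges: light vertices account for at most half
  of them, and a single heavy vertex for at most \<open>b * E / N\<close>.\<close>

lemma card_heavy:
  assumes "invariant st" and cS: "real (card (fst st)) \<le> 2 * p * N"
  shows "a / (4 * b) * N \<le> real (card (V \<inter> heavy st))"
proof -
  obtain S A' r' where st: "st = (S, A', r')" by (cases st)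
  let ?Av = "avail st"
  have big: "a * E / 2 \<le> real (card ?Av)" using card_avail assms st by auto
  have fin: "finite ?Av" using avail_subset finA finite_subset by blast
  have "real (card ?Av) = (\<Sum>e\<in>?Av. 1)" by simp
  \<comment> \<open>Singletons bring the degree sum into the form of \<open>sum_codegree\<close>.
    Edges are nonempty, so each is counted at least once.\<close>
  also have "\<dots> \<le> (\<Sum>e\<in>?Av. real (card {\<sigma> \<in> (\<lambda>v. {v}) ` V. \<sigma> \<subseteq> r e}))"
  proof (intro sum_mono)
    fix e assume "e \<in> ?Av"
    then have "e \<in> A" using avail_subset by blast
    then have "r e \<subseteq> V" "r e \<noteq> {}" using unif by (auto simp: uniform_on_def)
    then have "{\<sigma> \<in> (\<lambda>v. {v}) ` V. \<sigma> \<subseteq> r e} \<noteq> {}" by blast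
    then have "card {\<sigma> \<in> (\<lambda>v. {v}) ` V. \<sigma> \<subseteq> r e} > 0" using finV by (simp add: card_gt_0_iff)
    then show "1 \<le> real (card {\<sigma> \<in> (\<lambda>v. {v}) ` V. \<sigma> \<subseteq> r e})" by linarith
  qed
  also have "\<dots> = real (\<Sum>\<sigma>\<in>(\<lambda>v. {v}) ` V. codegree ?Av r \<sigma>)"
    using sum_codegree[OF fin, of "(\<lambda>v. {v}) ` V" r] finV by simp
  also have "\<dots> = (\<Sum>v\<in>V. real (codegree ?Av r {v}))"
    by (subst sum.reindex) (auto simp: inj_on_def)
  also have "\<dots> = (\<Sum>v\<in>V \<inter> heavy st. real (codegree ?Av r {v})) + (\<Sum>v\<in>V - heavy st. real (codegree ?Av r {v}))"
    by (rule sum.Int_Diff[OF finV])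
  also have "\<dots> \<le> (\<Sum>v\<in>V \<inter> heavy st. b * E / N) + (\<Sum>v\<in>V - heavy st. thr)"
  proof (intro add_mono sum_mono)
    fix v show "real (codegree ?Av r {v}) \<le> b * E / N"
      using codegree_mono[OF finA avail_subset, of st r "{v}"] codegree_single_le[of v] by simp
  qed (auto simp: heavy_def)
  also have "\<dots> \<le> real (card (V \<inter> heavy st)) * (b * E / N) + N * thr"
  proof -
    have "card (V - heavy st) \<le> card V" using finV by (intro card_mono) auto
    then have "real (card (V - heavy st)) * thr \<le> N * thr"
      using cardV thr0 by (intro mult_right_mono) auto
    then show ?thesis by simp
  qed
  also have "N * thr = a * E / 4" using N0 by (simp add: thr_def)
  finally have "a * E / 4 \<le> real (card (V \<inter> heavy st)) * (b * E / N)" using big by linarith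
  then have "E * (a / 4) \<le> E * (real (card (V \<inter> heavy st)) * b / N)" by (simp add: algebra_simps)
  then have "a / 4 \<le> real (card (V \<inter> heavy st)) * b / N" using E0 mult_le_cancel_left_pos by blast
  then show ?thesis using b0 N0 by (simp add: field_simps)
qed

lemma
  assumes "run t I = (S, A', r')"
  shows run_finite: "finite S" and run_subset: "A' \<subseteq> A"
    and run_residue: "\<forall>e\<in>A'. \<exists>v\<in>S. v \<in> r e \<and> r' e = r e - {v}"
    and run_many: "real (card S) * thr \<le> real (card A')"
    and codegree_bounded_run: "codegree_bounded p (p * E) N (cap + b) A' r'"
  using invariant_run[of t I, unfolded assms invariant.simps] by blast+

lemma uniform_on_run:
  assumes "run t I = (S, A', r')"
  shows "uniform_on V s A' r'"
proof -
  note A' = run_subset[OF assms] and r' = run_residue[OF assms]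
  have "r' e \<subseteq> V \<and> card (r' e) = s" if e: "e \<in> A'" for e
  proof -
    obtain v where v: "v \<in> r e" "r' e = r e - {v}" using r' e by blast
    have "r e \<subseteq> V" "card (r e) = Suc s" using e A' unif by (auto simp: uniform_on_def)
    then show ?thesis using v by auto
  qed
  then show ?thesis using A' finA finite_subset unfolding uniform_on_def by blast
qed

text \<open>A shortened edge lacks only a vertex of \<open>S\<close>, and \<open>S\<close> is
  contained in \<open>I\<close>; a shortened edge inside \<open>I\<close> would thus extend to an
  original one.\<close>

lemma stable_run:
  assumes "run t I = (S, A', r')" "stable A r I"
  shows "stable A' r' I"
  unfolding stable_def
proof (intro ballI notI)
  fix e assume e: "e \<in> A'" "r' e \<subseteq> I"
  have "fst (run t I) \<subseteq> I" using fingerprinting_run unfolding fingerprinting_def by blast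
  then have "S \<subseteq> I" using assms(1) by simp
  moreover obtain v where "v \<in> S" "r' e = r e - {v}" using run_residue[OF assms(1)] e(1) by blast
  ultimately have "r e \<subseteq> I" "e \<in> A" using e run_subset[OF assms(1)] by auto
  then show False using assms(2) unfolding stable_def by blast
qed

text \<open>Either \<open>T\<close> vertices are picked and the lower hypergraph is dense enough for
  recursion, or the run stalls. In the second case \<open>I\<close> misses all heavy vertices, and
  removing these from \<open>V\<close> gives a container at once.\<close>

lemma container_round:
  assumes rec: "\<And>A' r' :: 'i \<Rightarrow> 'v set. uniform_on V s A' r' \<Longrightarrow> a / 4 * (p * E) \<le> real (card A') \<Longrightarrow>
      codegree_bounded p (p * E) N (cap + b) A' r' \<Longrightarrow>
      \<exists>g. container_map A' r' V (K * p * N) (\<lambda>C. d * N \<le> real (card (V - C))) g"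
    and K0: "0 \<le> K"
  shows "\<exists>f. container_map A r V ((K + 2) * p * N) (\<lambda>C. min d (a / (4 * b)) * N \<le> real (card (V - C))) f"
proof -
  \<comment> \<open>Rounding up costs at most a factor 2 because \<open>1 \<le> p * N\<close>; hence
    the summand 2 in \<open>K + 2\<close>.\<close>
  define T where "T = nat \<lceil>p * N\<rceil>"
  have T: "p * N \<le> real T" "real T \<le> 2 * p * N" using pN by (simp_all add: T_def) linarith
  define good where "good A' r' \<longleftrightarrow> uniform_on V s A' r' \<and> a / 4 * (p * E) \<le> real (card A') \<and>
      codegree_bounded p (p * E) N (cap + b) A' r'" for A' and r' :: "'i \<Rightarrow> 'v set"
  have "\<exists>g. good A' r' \<longrightarrow> container_map A' r' V (K * p * N) (\<lambda>C. d * N \<le> real (card (V - C))) g" for A' r'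
    using rec[of A' r'] unfolding good_def by blast
  then obtain g where g: "\<And>A' r'. good A' r' \<Longrightarrow>
      container_map A' r' V (K * p * N) (\<lambda>C. d * N \<le> real (card (V - C))) (g A' r')"
    by metis
  \<comment> \<open>The whole state takes the place of the container, so that the branch and the
    recursive map depend on \<open>I\<close> only through reproducible data.\<close>
  define f0 where "f0 I = (let st = run T I in (fst st, st))" for I
  have f0: "fingerprinting f0"
    using fingerprinting_run[of T] by (simp add: fingerprinting_def f0_def Let_def)
  let ?Q = "\<lambda>(S, A', r'). card S = T \<and> good A' r'"
  define f where "f = (\<lambda>I. let (S, st) = f0 I in
           if ?Q st then (S \<union> fst ((case st of (_, A', r') \<Rightarrow> g A' r') I), snd ((case st of (_, A', r') \<Rightarrow> g A' r') I))
           else (S, V - heavy st))"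
  have "fingerprinting f" unfolding f_def
    by (rule fingerprinting_bind[OF f0, where h = "\<lambda>_ x. x" and k = "\<lambda>st. V - heavy st"]) (use container_mapD(1)[OF g] in auto)
  moreover have "real (card (fst (f I))) \<le> (K + 2) * p * N \<and> I \<subseteq> snd (f I) \<and> snd (f I) \<subseteq> V \<and>
        min d (a / (4 * b)) * N \<le> real (card (V - snd (f I)))"
    if I: "I \<subseteq> V" "stable A r I" for I
  proof -
    obtain S A' r' where st: "run T I = (S, A', r')" by (cases "run T I")
    have cS: "card S \<le> T" using card_run[of T I] st by simp
    then have cS2: "real (card S) \<le> 2 * p * N" using T by linarith
    note finS = run_finite[OF st] run_many[OF st]
    show ?thesis
    proof (cases "card S = T")
      case True
      have "p * N * thr \<le> real T * thr" using T thr0 by (intro mult_right_mono) auto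
      moreover have "p * N * thr = a / 4 * (p * E)" using N0 by (simp add: thr_def)
      moreover have "real T * thr \<le> real (card A')" using finS(2) True by simp
      ultimately have "a / 4 * (p * E) \<le> real (card A')" by linarith
      then have gd: "good A' r'"
        using uniform_on_run[OF st] codegree_bounded_run[OF st] by (simp add: good_def)
      have fI: "f I = (S \<union> fst (g A' r' I), snd (g A' r' I))"
        using True gd by (simp add: f_def f0_def st)
      have *: "real (card (fst (g A' r' I))) \<le> K * p * N \<and> I \<subseteq> snd (g A' r' I) \<and> snd (g A' r' I) \<subseteq> V \<and>
        d * N \<le> real (card (V - snd (g A' r' I)))"
        by (rule container_mapD(2)[OF g[OF gd] I(1) stable_run[OF st I(2)]])
      have "real (card (S \<union> fst (g A' r' I))) \<le> real (card S) + real (card (fst (g A' r' I)))"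
        by (metis card_Un_le of_nat_add of_nat_le_iff)
      also have "\<dots> \<le> (K + 2) * p * N" using * cS2 by (simp add: algebra_simps)
      finally have "real (card (S \<union> fst (g A' r' I))) \<le> (K + 2) * p * N" .
      moreover have "min d (a / (4 * b)) * N \<le> d * N" using N0 by (intro mult_right_mono) auto
      ultimately show ?thesis using * by (simp add: fI)
    next
      case False
      have fI: "f I = (S, V - heavy (run T I))" using False by (simp add: f_def f0_def st)
      have "I \<inter> heavy (run T I) = {}" using card_run_less[of T I] cS False st by simp
      moreover have "V - (V - heavy (run T I)) = V \<inter> heavy (run T I)" by blast
      moreover have "a / (4 * b) * N \<le> real (card (V \<inter> heavy (run T I)))"
        using card_heavy[OF invariant_run, of T I] cS2 st by simp
      moreover have "min d (a / (4 * b)) * N \<le> a / (4 * b) * N" using N0 by (intro mult_right_mono) auto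
      moreover have "2 * p * N \<le> (K + 2) * p * N" using K0 p0 N0 by (intro mult_right_mono) auto
      ultimately show ?thesis using I(1) cS2 unfolding fI by auto
    qed
  qed
  ultimately show ?thesis unfolding container_map_def by blast
qed

end

section \<open>Iterating rounds and containers\<close>

text \<open>Induction on the uniformity, with \<open>a\<close>, \<open>b\<close>, \<open>E\<close>
  replaced by \<open>a / 4\<close>, \<open>cap + b\<close>, \<open>p * E\<close>. All constants are
  fixed before the hypergraph, since they must be independent of the number of vertices.\<close>

lemma container_shrink:
  fixes a b :: real
  assumes "0 < a" "0 < b"
  shows "\<exists>K p0 d :: real. 0 \<le> K \<and> 0 < p0 \<and> 0 < d \<and>
    (\<forall>(A :: 'i set) (r :: 'i \<Rightarrow> 'v::countable set) V N p E.
       finite V \<longrightarrow> real (card V) \<le> N \<longrightarrow> 0 < p \<longrightarrow> p \<le> p0 \<longrightarrow> 1 \<le> p * N \<longrightarrow> 0 < E \<longrightarrow>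
       uniform_on V s A r \<longrightarrow> a * E \<le> real (card A) \<longrightarrow> codegree_bounded p E N b A r \<longrightarrow>
       (\<exists>f. container_map A r V (K * p * N) (\<lambda>C. d * N \<le> real (card (V - C))) f))"
  using assms
proof (induction s arbitrary: a b)
  case 0
  have "\<exists>f. container_map A r V (0 * p * N) (\<lambda>C. 1 * N \<le> real (card (V - C))) f"
    if "finite V" "uniform_on V 0 A r" "0 < E" "a * E \<le> real (card A)"
    for A :: "'i set" and r :: "'i \<Rightarrow> 'v set" and V N p E
  proof -
    have "0 < a * E" using that 0 by simp
    then have "A \<noteq> {}" using that(4) by auto
    then obtain e where e: "e \<in> A" by blast
    have "finite (r e)" "card (r e) = 0"
      using that(1,2) e finite_subset unfolding uniform_on_def by blast+
    \<comment> \<open>An empty edge lies inside every set, so no set is stable and the claim is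
      vacuous.\<close>
    then have "r e = {}" by simp
    then have "\<not> stable A r I" for I using e by (auto simp: stable_def)
    then show ?thesis
      unfolding container_map_def
      by (intro exI[of _ "\<lambda>_. ({}, {})"]) (simp add: fingerprinting_const)
  qed
  then show ?case
    by - (rule exI[of _ 0], rule exI[of _ 1], rule exI[of _ 1], auto)
next
  case (Suc s)
  \<comment> \<open>The value of \<open>cap\<close>, restated because the induction hypothesis is
    instantiated before any hypergraph is given.\<close>
  define c where "c = 2 ^ (s + 3) * b\<^sup>2 / a"
  have "0 < a / 4" "0 < c + b" using Suc.prems by (auto simp: c_def add_nonneg_pos)
  from Suc.IH[OF this] obtain K p0 d where K: "0 \<le> K" "0 < p0" "0 < d"
    and rec: "\<And>(A :: 'i set) (r :: 'i \<Rightarrow> 'v::countable set) V N p E.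
       finite V \<Longrightarrow> real (card V) \<le> N \<Longrightarrow> 0 < p \<Longrightarrow> p \<le> p0 \<Longrightarrow> 1 \<le> p * N \<Longrightarrow> 0 < E \<Longrightarrow>
       uniform_on V s A r \<Longrightarrow> a / 4 * E \<le> real (card A) \<Longrightarrow> codegree_bounded p E N (c + b) A r \<Longrightarrow>
       (\<exists>f. container_map A r V (K * p * N) (\<lambda>C. d * N \<le> real (card (V - C))) f)" by metis
  show ?case
  proof (rule exI[of _ "K + 2"], rule exI[of _ "min p0 (a / (8 * b))"], rule exI[of _ "min d (a / (4 * b))"],
      intro conjI allI impI)
    fix A :: "'i set" and r :: "'i \<Rightarrow> 'v set" and V N p E
    assume as: "finite V" "real (card V) \<le> N" "0 < p" "p \<le> min p0 (a / (8 * b))" "1 \<le> p * N" "0 < E"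
      "uniform_on V (Suc s) A r" "a * E \<le> real (card A)" "codegree_bounded p E N b A r"
    interpret container_round A r V s N p E a b
      by unfold_locales (use as Suc.prems in auto)
    have cap: "c = cap" by (simp add: c_def cap_def)
    have pE: "0 < p * E" using as by simp
    have "\<exists>g. container_map A' r' V (K * p * N) (\<lambda>C. d * N \<le> real (card (V - C))) g"
      if "uniform_on V s A' r'" "a / 4 * (p * E) \<le> real (card A')"
        "codegree_bounded p (p * E) N (cap + b) A' r'"
      for A' and r' :: "'i \<Rightarrow> 'v set"
      by (rule rec[OF as(1-3) _ as(5) pE that(1,2)]) (use that as cap in auto)
    from container_round[OF this K(1)]
    show "\<exists>f. container_map A r V ((K + 2) * p * N) (\<lambda>C. min d (a / (4 * b)) * N \<le> real (card (V - C))) f" .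
  qed (use K Suc.prems in auto)
qed

text \<open>As long as a container spans at least \<open>\<epsilon> * E\<close> edges, it is shrunk
  again. The shrinking step is applied to the edges inside it with unchanged \<open>N\<close>,
  \<open>E\<close> and \<open>b\<close>, so the constants do not deteriorate from one application to
  the next.\<close>

theorem containers:
  fixes \<epsilon> b :: real
  assumes \<epsilon>: "0 < \<epsilon>" and b: "0 < b"
  shows "\<exists>K p0 :: real. 0 \<le> K \<and> 0 < p0 \<and>
    (\<forall>(A :: 'i set) (r :: 'i \<Rightarrow> 'v::countable set) V N p E.
       finite V \<longrightarrow> real (card V) \<le> N \<longrightarrow> 0 < p \<longrightarrow> p \<le> p0 \<longrightarrow> 1 \<le> p * N \<longrightarrow> 0 < E \<longrightarrow>
       uniform_on V s A r \<longrightarrow> codegree_bounded p E N b A r \<longrightarrow>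
       (\<exists>f. container_map A r V (K * p * N) (\<lambda>C. real (card {e \<in> A. r e \<subseteq> C}) < \<epsilon> * E) f))"
proof -
  obtain K p0 d where K: "0 \<le> K" "0 < p0" "0 < d"
    and shrink: "\<And>(A :: 'i set) (r :: 'i \<Rightarrow> 'v::countable set) V N p E.
       finite V \<Longrightarrow> real (card V) \<le> N \<Longrightarrow> 0 < p \<Longrightarrow> p \<le> p0 \<Longrightarrow> 1 \<le> p * N \<Longrightarrow> 0 < E \<Longrightarrow>
       uniform_on V s A r \<Longrightarrow> \<epsilon> * E \<le> real (card A) \<Longrightarrow> codegree_bounded p E N b A r \<Longrightarrow>
       (\<exists>f. container_map A r V (K * p * N) (\<lambda>C. d * N \<le> real (card (V - C))) f)"
    using container_shrink[OF \<epsilon> b, where 'i = 'i and 'v = 'v, of s] by metis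
  \<comment> \<open>After \<open>M\<close> successful applications more than \<open>N\<close>
    vertices would have been removed, which is impossible.\<close>
  obtain M :: nat where M: "1 < real M * d" using K(3) reals_Archimedean3 by blast
  have main: "\<exists>f. container_map A r V (real M * K * p * N) (\<lambda>C. real (card {e \<in> A. r e \<subseteq> C}) < \<epsilon> * E) f"
    if as: "finite V" "real (card V) \<le> N" "0 < p" "p \<le> p0" "1 \<le> p * N" "0 < E"
      "uniform_on V s A r" "codegree_bounded p E N b A r"
    for A :: "'i set" and r :: "'i \<Rightarrow> 'v::countable set" and V N p E
  proof -
    define A' where "A' C = {e \<in> A. r e \<subseteq> C}" for C
    define rich where "rich C \<longleftrightarrow> C \<subseteq> V \<and> \<epsilon> * E \<le> real (card (A' C))" for C
    have finA: "finite A" using as by (simp add: uniform_on_def)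
    have N0: "0 < N" using as by (smt (verit) mult_nonneg_nonpos)
    have "\<exists>g. container_map (A' C) r C (K * p * N) (\<lambda>C'. d * N \<le> real (card (C - C'))) g"
      if C: "rich C" for C
    proof (rule shrink[OF _ _ as(3-6)])
      show "finite C" using C as(1) finite_subset by (auto simp: rich_def)
      have "card C \<le> card V" using C as(1) by (intro card_mono) (auto simp: rich_def)
      then show "real (card C) \<le> N" using as(2) by linarith
      show "uniform_on C s (A' C) r" using as(7) by (auto simp: uniform_on_def A'_def)
      show "\<epsilon> * E \<le> real (card (A' C))" using C by (simp add: rich_def)
      show "codegree_bounded p E N b (A' C) r"
        unfolding codegree_bounded_def
      proof (intro allI impI)
        fix \<sigma> :: "'v set" assume "finite \<sigma>" "\<sigma> \<noteq> {}"
        then have "real (codegree A r \<sigma>) \<le> b * p ^ (card \<sigma> - 1) * E / N"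
          using as(8) unfolding codegree_bounded_def by blast
        moreover have "codegree (A' C) r \<sigma> \<le> codegree A r \<sigma>" using finA by (intro codegree_mono) (auto simp: A'_def)
        ultimately show "real (codegree (A' C) r \<sigma>) \<le> b * p ^ (card \<sigma> - 1) * E / N" by linarith
      qed
    qed
    then obtain g where g: "\<And>C. rich C \<Longrightarrow>
        container_map (A' C) r C (K * p * N) (\<lambda>C'. d * N \<le> real (card (C - C'))) (g C)"
      by metis
    \<comment> \<open>Either the process has already stopped, or each of the \<open>m\<close>
      applications has removed \<open>d * N\<close> vertices.\<close>
    have "\<exists>f. container_map A r V (real m * K * p * N) (\<lambda>C. \<not> rich C \<or> real (card C) \<le> N - real m * d * N) f" for m
    proof (induction m)
      case 0
      show ?case using fingerprinting_const[of V] as(2)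
        by (intro exI[of _ "\<lambda>_. ({}, V)"]) (simp add: container_map_def)
    next
      case (Suc m)
      then obtain f where f: "container_map A r V (real m * K * p * N)
          (\<lambda>C. \<not> rich C \<or> real (card C) \<le> N - real m * d * N) f" by blast
      note fI = container_mapD(2)[OF f]
      define f' where "f' = (\<lambda>I. let (S, C) = f I in
           if rich C then (S \<union> fst (g C I), snd (g C I)) else (S, C))"
      have "fingerprinting f'" unfolding f'_def
        by (rule fingerprinting_bind[OF container_mapD(1)[OF f], where h = "\<lambda>_ x. x" and k = "\<lambda>x. x"])
          (use container_mapD(1)[OF g] in auto)
      moreover have "real (card (fst (f' I))) \<le> real (Suc m) * K * p * N \<and> I \<subseteq> snd (f' I) \<and> snd (f' I) \<subseteq> V \<and>
          (\<not> rich (snd (f' I)) \<or> real (card (snd (f' I))) \<le> N - real (Suc m) * d * N)"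
        if I: "I \<subseteq> V" "stable A r I" for I
      proof -
        obtain S C where SC: "f I = (S, C)" by fastforce
        have 1: "real (card S) \<le> real m * K * p * N" "I \<subseteq> C" "C \<subseteq> V"
          "\<not> rich C \<or> real (card C) \<le> N - real m * d * N" using fI[OF I] SC by auto
        have KpN: "0 \<le> K * p * N" using K as(3) N0 by simp
        show ?thesis
        proof (cases "rich C")
          case False
          then show ?thesis using 1 KpN by (simp add: f'_def SC algebra_simps)
        next
          case True
          have "stable (A' C) r I" using I by (auto simp: stable_def A'_def)
          then have 2: "real (card (fst (g C I))) \<le> K * p * N" "I \<subseteq> snd (g C I)" "snd (g C I) \<subseteq> C"
            "d * N \<le> real (card (C - snd (g C I)))"
            using container_mapD(2)[OF g[OF True] 1(2)] by blast+
          have "real (card (S \<union> fst (g C I))) \<le> real (card S) + real (card (fst (g C I)))"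
            by (metis card_Un_le of_nat_add of_nat_le_iff)
          also have "\<dots> \<le> real (Suc m) * K * p * N" using 1 2 by (simp add: algebra_simps)
          finally have 3: "real (card (S \<union> fst (g C I))) \<le> real (Suc m) * K * p * N" .
          have finC: "finite C" using 1(3) as(1) finite_subset by blast
          have "card (C - snd (g C I)) = card C - card (snd (g C I))" "card (snd (g C I)) \<le> card C"
            using 2(3) finC by (auto intro: card_Diff_subset card_mono finite_subset)
          then have "real (card (snd (g C I))) \<le> N - real (Suc m) * d * N"
            using 1(4) True 2(4) by (simp add: algebra_simps)
          then show ?thesis using 1 2 3 True by (auto simp: f'_def SC)
        qed
      qed
      ultimately show ?case unfolding container_map_def by blast
    qed
    from this[of M] obtain f where f: "container_map A r V (real M * K * p * N)
          (\<lambda>C. \<not> rich C \<or> real (card C) \<le> N - real M * d * N) f" by blast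
    note fI = container_mapD(2)[OF f]
    have "1 * N < real M * d * N" using M N0 by (intro mult_strict_right_mono) auto
    then have "N - real M * d * N < 0" by simp
    then have "\<not> real c \<le> N - real M * d * N" for c :: nat
      by (smt (verit) of_nat_0_le_iff)
    then have "real (card (A' (snd (f I)))) < \<epsilon> * E" if "I \<subseteq> V" "stable A r I" for I
      using fI[OF that] unfolding rich_def by auto
    then show ?thesis
      using container_mapD(1)[OF f] fI unfolding A'_def container_map_def by blast
  qed
  show ?thesis
    using K main by - (rule exI[of _ "real M * K"], rule exI[of _ p0], auto)
qed

section \<open>Supersaturation of acyclic digraphs\<close>

text \<open>Out- and in-neighbours of \<open>x\<close> cover the at least
  \<open>2 * 2 ^ h - 1\<close> other points, so one of the two classes has \<open>2 ^ h\<close>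
  elements. Recursion there leaves \<open>x\<close> to be placed in front or at the end.\<close>

lemma transitive_subtournament:
  assumes "finite X" "2 ^ h \<le> card X"
    and "\<And>u v. u \<in> X \<Longrightarrow> v \<in> X \<Longrightarrow> u \<noteq> v \<Longrightarrow> (u, v) \<in> T \<or> (v, u) \<in> T"
  shows "\<exists>xs. length xs = h \<and> set xs \<subseteq> X \<and> distinct xs \<and> sorted_wrt (\<lambda>u v. (u, v) \<in> T) xs"
  using assms
proof (induction h arbitrary: X)
  case 0
  then show ?case by (intro exI[of _ "[]"]) simp
next
  case (Suc h)
  have "card X > 0" using Suc.prems(2) by (metis gr0I le_zero_eq power_not_zero zero_neq_numeral)
  then obtain x where x: "x \<in> X" by fastforce
  define Out In where "Out = {v \<in> X - {x}. (x, v) \<in> T}" and "In = {v \<in> X - {x}. (v, x) \<in> T}"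
  have sub: "Out \<subseteq> X" "In \<subseteq> X" by (auto simp: Out_def In_def)
  have fin: "finite Out" "finite In" using sub Suc.prems(1) finite_subset by blast+
  have "X - {x} \<subseteq> Out \<union> In" using Suc.prems(3) x by (auto simp: Out_def In_def)
  then have "card (X - {x}) \<le> card (Out \<union> In)" using fin by (intro card_mono) auto
  also have "\<dots> \<le> card Out + card In" by (rule card_Un_le)
  finally have "2 * 2 ^ h \<le> Suc (card Out + card In)" using Suc.prems x by simp
  then consider "2 ^ h \<le> card Out" | "2 ^ h \<le> card In" by linarith
  then show ?case
  proof cases
    case 1
    then obtain xs where "length xs = h" "set xs \<subseteq> Out" "distinct xs" "sorted_wrt (\<lambda>u v. (u, v) \<in> T) xs"
      using Suc.IH[OF fin(1)] Suc.prems(3) sub(1) by blast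
    then show ?thesis using x sub(1)
      by (intro exI[of _ "x # xs"]) (auto simp: Out_def)
  next
    case 2
    then obtain xs where "length xs = h" "set xs \<subseteq> In" "distinct xs" "sorted_wrt (\<lambda>u v. (u, v) \<in> T) xs"
      using Suc.IH[OF fin(2)] Suc.prems(3) sub(2) by blast
    then show ?thesis using x sub(2)
      by (intro exI[of _ "xs @ [x]"]) (auto simp: In_def sorted_wrt_append)
  qed
qed

text \<open>A finite acyclic relation has a sink; it receives the largest number and is
  removed.\<close>

lemma topological_numbering:
  assumes "finite W" "acyclic R" "R \<subseteq> W \<times> W"
  shows "\<exists>f. inj_on f W \<and> f ` W \<subseteq> {..<card W} \<and> (\<forall>(u, v)\<in>R. f u < (f v :: nat))"
  using assms
proof (induction "card W" arbitrary: W R)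
  case 0
  then show ?case by auto
next
  case (Suc k)
  have "finite R" using Suc.prems finite_subset by blast
  then have "wf (R\<inverse>)" using Suc.prems(2) by (intro finite_acyclic_wf_converse)
  moreover have "W \<noteq> {}" using Suc.hyps(2) by auto
  ultimately obtain z where z: "z \<in> W" "\<And>y. (z, y) \<in> R \<Longrightarrow> y \<notin> W"
    by (metis all_not_in_conv converse_iff wfE_min)
  define R' where "R' = R \<inter> (W - {z}) \<times> (W - {z})"
  have k: "k = card (W - {z})" using Suc.hyps(2) z(1) Suc.prems(1) by simp
  have "acyclic R'" unfolding R'_def by (rule acyclic_subset[OF Suc.prems(2)]) blast
  moreover have "finite (W - {z})" "R' \<subseteq> (W - {z}) \<times> (W - {z})" using Suc.prems(1) by (auto simp: R'_def)
  ultimately have "\<exists>f. inj_on f (W - {z}) \<and> f ` (W - {z}) \<subseteq> {..<k} \<and> (\<forall>(u, v)\<in>R'. f u < (f v :: nat))"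
    using Suc.hyps(1)[OF k, of R'] k by simp
  then obtain f where f: "inj_on f (W - {z})" "f ` (W - {z}) \<subseteq> {..<k}" "\<forall>(u, v)\<in>R'. f u < f v"
    by (elim exE conjE)
  let ?f = "f(z := k)"
  have "inj_on ?f W" using f(1,2) by (fastforce simp: inj_on_def)
  moreover have "?f ` W \<subseteq> {..<card W}" using f(2) Suc.hyps(2) by (fastforce simp: image_subset_iff)
  moreover have "?f u < ?f v" if uv: "(u, v) \<in> R" for u v
  proof -
    have "u \<noteq> z" using z(2) uv Suc.prems(3) by blast
    have W: "u \<in> W" "v \<in> W" using uv Suc.prems(3) by auto
    show ?thesis
    proof (cases "v = z")
      case True
      then show ?thesis using \<open>u \<noteq> z\<close> W f(2) by auto
    next
      case False
      then show ?thesis using \<open>u \<noteq> z\<close> W f(3) uv by (auto simp: R'_def)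
    qed
  qed
  ultimately show ?case by blast
qed

section \<open>Counting embeddings\<close>

text \<open>A function is recovered from \<open>g f\<close>, which fixes it on \<open>B\<close>,
  together with its restriction to the remaining points.\<close>

lemma card_determined_le:
  assumes "finite U" "B \<subseteq> U" "finite Y" "finite Z"
    and det: "\<And>f f' x. f \<in> U \<rightarrow>\<^sub>E Y \<Longrightarrow> f' \<in> U \<rightarrow>\<^sub>E Y \<Longrightarrow> g f = g f' \<Longrightarrow> x \<in> B \<Longrightarrow> f x = f' x"
  shows "card {f \<in> U \<rightarrow>\<^sub>E Y. g f \<in> Z} \<le> card Z * card Y ^ (card U - card B)"
proof -
  let ?F = "\<lambda>f. (g f, restrict f (U - B))"
  have "inj_on ?F {f \<in> U \<rightarrow>\<^sub>E Y. g f \<in> Z}"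
  proof (rule inj_onI)
    fix f f' assume f: "f \<in> {f \<in> U \<rightarrow>\<^sub>E Y. g f \<in> Z}" "f' \<in> {f \<in> U \<rightarrow>\<^sub>E Y. g f \<in> Z}" "?F f = ?F f'"
    show "f = f'"
    proof (rule PiE_ext[of f U "\<lambda>_. Y" f'])
      fix x assume "x \<in> U"
      show "f x = f' x"
      proof (cases "x \<in> B")
        case True
        then show ?thesis using f det by auto
      next
        case False
        have "restrict f (U - B) x = restrict f' (U - B) x" using f(3) by simp
        then show ?thesis using False \<open>x \<in> U\<close> by simp
      qed
    qed (use f in auto)
  qed
  moreover have "?F ` {f \<in> U \<rightarrow>\<^sub>E Y. g f \<in> Z} \<subseteq> Z \<times> ((U - B) \<rightarrow>\<^sub>E Y)" by auto
  moreover have "finite (Z \<times> ((U - B) \<rightarrow>\<^sub>E Y))"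
    using assms by (intro finite_cartesian_product finite_PiE) auto
  ultimately have "card {f \<in> U \<rightarrow>\<^sub>E Y. g f \<in> Z} \<le> card (Z \<times> ((U - B) \<rightarrow>\<^sub>E Y))"
    by (rule card_inj_on_le)
  also have "\<dots> = card Z * card Y ^ (card U - card B)"
    using assms by (simp add: card_cartesian_product card_PiE card_Diff_subset finite_subset)
  finally show ?thesis .
qed

text \<open>Copies are counted with labels, so an arc set may arise from several embeddings; indexed
  hypergraphs tolerate this repetition.\<close>

definition embeddings :: "'a set \<Rightarrow> nat \<Rightarrow> ('a \<Rightarrow> nat) set" where
  "embeddings W n = {\<phi> \<in> W \<rightarrow>\<^sub>E {..<n}. inj_on \<phi> W}"

definition arc_image :: "('a \<times> 'a) set \<Rightarrow> ('a \<Rightarrow> nat) \<Rightarrow> (nat \<times> nat) set" where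
  "arc_image R \<phi> = map_prod \<phi> \<phi> ` R"

definition all_arcs :: "nat \<Rightarrow> (nat \<times> nat) set" where
  "all_arcs n = {(u, v). u < n \<and> v < n \<and> u \<noteq> v}"

text \<open>Each nonadjacent pair is counted in both orders.\<close>

definition nonadjacent :: "nat \<Rightarrow> (nat \<times> nat) set \<Rightarrow> (nat \<times> nat) set" where
  "nonadjacent n D = {(u, v) \<in> all_arcs n. (u, v) \<notin> D \<and> (v, u) \<notin> D}"

lemma finite_all_arcs: "finite (all_arcs n)"
  and card_all_arcs_le: "card (all_arcs n) \<le> n\<^sup>2"
proof -
  have sub: "all_arcs n \<subseteq> {..<n} \<times> {..<n}" by (auto simp: all_arcs_def)
  then show "finite (all_arcs n)" by (rule finite_subset) simp
  have "card (all_arcs n) \<le> card ({..<n} \<times> {..<n})" using sub by (intro card_mono) auto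
  then show "card (all_arcs n) \<le> n\<^sup>2" by (simp add: power2_eq_square)
qed

lemma finite_nonadjacent: "finite (nonadjacent n D)"
  by (rule finite_subset[OF _ finite_all_arcs[of n]]) (auto simp: nonadjacent_def)

lemma finite_embeddings: "finite W \<Longrightarrow> finite (embeddings W n)"
  unfolding embeddings_def by (simp add: finite_PiE)

lemma arc_image_embedding:
  assumes "\<phi> \<in> embeddings W n" "R \<subseteq> W \<times> W" "irrefl R"
  shows "arc_image R \<phi> \<subseteq> all_arcs n" "card (arc_image R \<phi>) = card R"
proof -
  have inj: "inj_on \<phi> W" and im: "\<And>w. w \<in> W \<Longrightarrow> \<phi> w < n" using assms(1) by (auto simp: embeddings_def)
  show "arc_image R \<phi> \<subseteq> all_arcs n"
  proof
    fix e assume "e \<in> arc_image R \<phi>"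
    then obtain u v where uv: "(u, v) \<in> R" "e = (\<phi> u, \<phi> v)" by (auto simp: arc_image_def)
    then have "u \<in> W" "v \<in> W" "u \<noteq> v" using assms(2,3) by (auto simp: irrefl_def)
    then show "e \<in> all_arcs n" using inj im uv by (auto simp: all_arcs_def inj_on_def)
  qed
  have "inj_on (map_prod \<phi> \<phi>) R"
    using map_prod_inj_on[OF inj inj] assms(2) inj_on_subset by blast
  then show "card (arc_image R \<phi>) = card R" by (simp add: arc_image_def card_image)
qed

text \<open>Laying out \<open>W\<close> along a transitive subtournament in topological order turns
  every arc of \<open>R\<close> into a forward arc. The map \<open>\<tau>\<close> into the sample is
  kept explicit, since the later count sums over it.\<close>

lemma embedding_in_tournament:
  fixes \<psi> :: "nat \<Rightarrow> nat"
  assumes W: "finite W" and acyc: "acyclic R" and R: "R \<subseteq> W \<times> W"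
    and \<psi>: "inj_on \<psi> {..<2 ^ card W}" "\<psi> ` {..<2 ^ card W} \<subseteq> {..<n}"
    and full: "\<And>i j. i < 2 ^ card W \<Longrightarrow> j < 2 ^ card W \<Longrightarrow> i \<noteq> j \<Longrightarrow> (\<psi> i, \<psi> j) \<notin> nonadjacent n D"
  shows "\<exists>\<tau>. \<tau> \<in> W \<rightarrow>\<^sub>E {..<2 ^ card W} \<and> inj_on \<tau> W \<and>
    restrict (\<psi> \<circ> \<tau>) W \<in> embeddings W n \<and> arc_image R (restrict (\<psi> \<circ> \<tau>) W) \<subseteq> D"
proof -
  let ?Q = "2 ^ card W :: nat"
  have "(i, j) \<in> {(i, j). (\<psi> i, \<psi> j) \<in> D} \<or> (j, i) \<in> {(i, j). (\<psi> i, \<psi> j) \<in> D}"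
    if "i \<in> {..<?Q}" "j \<in> {..<?Q}" "i \<noteq> j" for i j
  proof -
    have "(\<psi> i, \<psi> j) \<in> all_arcs n" using that \<psi> by (auto simp: all_arcs_def inj_on_def)
    then show ?thesis using full[of i j] that by (auto simp: nonadjacent_def)
  qed
  from transitive_subtournament[of "{..<?Q}" "card W", OF _ _ this]
  obtain xs where xs: "length xs = card W" "set xs \<subseteq> {..<?Q}" "distinct xs"
    "sorted_wrt (\<lambda>i j. (\<psi> i, \<psi> j) \<in> D) xs" by auto
  obtain f where f: "inj_on f W" "f ` W \<subseteq> {..<card W}" "\<forall>(u, v)\<in>R. f u < f v"
    using topological_numbering[OF W acyc R] by blast
  define \<tau> where "\<tau> = restrict (\<lambda>w. xs ! f w) W"
  have fl: "f w < length xs" if "w \<in> W" for w using that f(2) xs(1) by auto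
  have \<tau>Q: "\<tau> w \<in> {..<?Q}" if "w \<in> W" for w
  proof -
    have "xs ! f w \<in> set xs" using fl[OF that] by (rule nth_mem)
    then show ?thesis using xs(2) that unfolding \<tau>_def by auto
  qed
  then have 1: "\<tau> \<in> W \<rightarrow>\<^sub>E {..<?Q}" by (auto simp: \<tau>_def)
  have 2: "inj_on \<tau> W"
    using f(1) xs(3) fl unfolding inj_on_def \<tau>_def by (simp add: nth_eq_iff_index_eq)
  have "inj_on (\<psi> \<circ> \<tau>) W"
    using 2 \<tau>Q \<psi>(1) by (intro comp_inj_on) (auto intro: inj_on_subset)
  then have 3: "restrict (\<psi> \<circ> \<tau>) W \<in> embeddings W n"
    using \<tau>Q \<psi>(2) by (auto simp: embeddings_def inj_on_restrict_eq image_subset_iff)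
  have "arc_image R (restrict (\<psi> \<circ> \<tau>) W) \<subseteq> D"
  proof
    fix e assume "e \<in> arc_image R (restrict (\<psi> \<circ> \<tau>) W)"
    then obtain u v where uv: "(u, v) \<in> R" "e = map_prod (restrict (\<psi> \<circ> \<tau>) W) (restrict (\<psi> \<circ> \<tau>) W) (u, v)"
      unfolding arc_image_def by (metis imageE prod.exhaust)
    have W: "u \<in> W" "v \<in> W" using uv(1) R by auto
    have "f u < f v" using f(3) uv by blast
    then have "(\<psi> (xs ! f u), \<psi> (xs ! f v)) \<in> D" using xs(4) fl[OF W(2)] by (auto simp: sorted_wrt_iff_nth_less)
    then show "e \<in> D" using uv W by (simp add: \<tau>_def)
  qed
  with 1 2 3 show ?thesis by blast
qed

text \<open>
  Every map of \<open>Q\<close> points into the \<open>n\<close> vertices identifies two points, or hits a nonadjacent pair, or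
  contains a tournament on \<open>2 ^ card W\<close> vertices and hence a copy of \<open>R\<close>.
\<close>

lemma supersaturation_count:
  assumes W: "finite W" and acyc: "acyclic R" and R: "R \<subseteq> W \<times> W"
    and Q: "Q = 2 ^ card W"
  shows "n ^ Q \<le> Q\<^sup>2 * ((n + card (nonadjacent n D)) * n ^ (Q - 2)) +
     Q ^ card W * (card {\<phi> \<in> embeddings W n. arc_image R \<phi> \<subseteq> D} * n ^ (Q - card W))"
proof -
  let ?F = "{..<Q} \<rightarrow>\<^sub>E {..<n}"
  let ?P = "{(i, j). i < Q \<and> j < Q \<and> i \<noteq> j}"
  let ?X = "{\<tau> \<in> W \<rightarrow>\<^sub>E {..<Q}. inj_on \<tau> W}"
  \<comment> \<open>Adding the diagonal treats a collision of two sample points like a nonadjacent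
    pair.\<close>
  let ?M = "nonadjacent n D \<union> (\<lambda>u. (u, u)) ` {..<n}"
  let ?E = "{\<phi> \<in> embeddings W n. arc_image R \<phi> \<subseteq> D}"
  let ?G = "\<lambda>ij. {\<psi> \<in> ?F. (\<psi> (fst ij), \<psi> (snd ij)) \<in> ?M}"
  let ?H = "\<lambda>\<tau>. {\<psi> \<in> ?F. restrict (\<psi> \<circ> \<tau>) W \<in> ?E}"
  have finF: "finite ?F" by (simp add: finite_PiE)
  have finP: "finite ?P" by (rule finite_subset[of _ "{..<Q} \<times> {..<Q}"]) auto
  have finX: "finite ?X" using W by (simp add: finite_PiE)
  have cover: "?F \<subseteq> (\<Union>ij\<in>?P. ?G ij) \<union> (\<Union>\<tau>\<in>?X. ?H \<tau>)"
  proof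
    fix \<psi> assume \<psi>: "\<psi> \<in> ?F"
    show "\<psi> \<in> (\<Union>ij\<in>?P. ?G ij) \<union> (\<Union>\<tau>\<in>?X. ?H \<tau>)"
    proof (cases "\<exists>i j. i < Q \<and> j < Q \<and> i \<noteq> j \<and> (\<psi> i, \<psi> j) \<in> ?M")
      case True
      then obtain i j where ij: "i < Q" "j < Q" "i \<noteq> j" "(\<psi> i, \<psi> j) \<in> ?M" by (elim exE conjE)
      then have "(i, j) \<in> ?P" "\<psi> \<in> ?G (i, j)" using \<psi> by simp_all
      then show ?thesis by blast
    next
      case False
      have \<psi>n: "\<psi> i < n" if "i < Q" for i using PiE_mem[OF \<psi>, of i] that by simp
      have 1: "inj_on \<psi> {..<2 ^ card W}"
      proof (rule inj_onI)
        fix i j assume ij: "i \<in> {..<2 ^ card W}" "j \<in> {..<2 ^ card W}" "\<psi> i = \<psi> j"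
        have "(\<psi> i, \<psi> j) \<in> ?M"
          using ij(1,3) \<psi>n[of i] Q by (intro UnI2 image_eqI[of _ _ "\<psi> i"]) simp_all
        then show "i = j" using False ij Q by blast
      qed
      have 2: "\<psi> ` {..<2 ^ card W} \<subseteq> {..<n}" using \<psi>n Q by auto
      have 3: "(\<psi> i, \<psi> j) \<notin> nonadjacent n D"
        if "i < 2 ^ card W" "j < 2 ^ card W" "i \<noteq> j" for i j using False that Q by blast
      obtain \<tau> where "\<tau> \<in> W \<rightarrow>\<^sub>E {..<2 ^ card W}" "inj_on \<tau> W"
        "restrict (\<psi> \<circ> \<tau>) W \<in> embeddings W n" "arc_image R (restrict (\<psi> \<circ> \<tau>) W) \<subseteq> D"
        using embedding_in_tournament[OF W acyc R 1 2, of D] 3 by metis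
      then have "\<tau> \<in> ?X" "\<psi> \<in> ?H \<tau>" using \<psi> Q by simp_all
      then show ?thesis by blast
    qed
  qed
  have "n ^ Q = card ?F" by (simp add: card_PiE)
  also have "\<dots> \<le> card ((\<Union>ij\<in>?P. ?G ij) \<union> (\<Union>\<tau>\<in>?X. ?H \<tau>))"
    using cover finF finP finX by (intro card_mono) auto
  also have "\<dots> \<le> card (\<Union>ij\<in>?P. ?G ij) + card (\<Union>\<tau>\<in>?X. ?H \<tau>)" by (rule card_Un_le)
  also have "\<dots> \<le> (\<Sum>ij\<in>?P. card (?G ij)) + (\<Sum>\<tau>\<in>?X. card (?H \<tau>))"
    using finP finX by (intro add_mono card_UN_le)
  also have "\<dots> \<le> (\<Sum>ij\<in>?P. (n + card (nonadjacent n D)) * n ^ (Q - 2)) + (\<Sum>\<tau>\<in>?X. card ?E * n ^ (Q - card W))"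
  proof (intro add_mono sum_mono)
    fix ij assume "ij \<in> ?P"
    then obtain i j where ij: "ij = (i, j)" "i < Q" "j < Q" "i \<noteq> j" by auto
    \<comment> \<open>The pair of values determines the sample at \<open>i\<close> and
      \<open>j\<close>, leaving \<open>Q - 2\<close> free coordinates.\<close>
    have "card (?G ij) \<le> card ?M * card {..<n} ^ (card {..<Q} - card {i, j})"
      using ij by (intro card_determined_le) (auto simp: finite_nonadjacent)
    also have "card {i, j} = 2" using ij by simp
    also have "card ?M * card {..<n} ^ (card {..<Q} - 2) \<le> (n + card (nonadjacent n D)) * n ^ (Q - 2)"
    proof -
      have "card ?M \<le> card (nonadjacent n D) + card ((\<lambda>u. (u, u)) ` {..<n})" by (rule card_Un_le)
      also have "\<dots> \<le> card (nonadjacent n D) + n"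
        using card_image_le[of "{..<n}" "\<lambda>u. (u, u)"] by simp
      finally show ?thesis by (simp add: add.commute)
    qed
    finally show "card (?G ij) \<le> (n + card (nonadjacent n D)) * n ^ (Q - 2)" .
  next
    fix \<tau> assume \<tau>: "\<tau> \<in> ?X"
    have "card (?H \<tau>) \<le> card ?E * card {..<n} ^ (card {..<Q} - card (\<tau> ` W))"
    proof (rule card_determined_le)
      fix f f' x assume eq: "restrict (f \<circ> \<tau>) W = restrict (f' \<circ> \<tau>) W" and x: "x \<in> \<tau> ` W"
      then obtain w where w: "w \<in> W" "x = \<tau> w" by blast
      have "restrict (f \<circ> \<tau>) W w = restrict (f' \<circ> \<tau>) W w" using eq by simp
      then show "f x = f' x" using w by simp
    qed (use \<tau> finite_embeddings[OF W] in auto)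
    moreover have "card (\<tau> ` W) = card W" using \<tau> by (auto intro: card_image)
    ultimately show "card (?H \<tau>) \<le> card ?E * n ^ (Q - card W)" by simp
  qed
  also have "\<dots> \<le> Q\<^sup>2 * ((n + card (nonadjacent n D)) * n ^ (Q - 2)) + Q ^ card W * (card ?E * n ^ (Q - card W))"
  proof -
    have "card ?P \<le> card ({..<Q} \<times> {..<Q})" by (intro card_mono) auto
    then have P: "card ?P \<le> Q\<^sup>2" by (simp add: power2_eq_square)
    have "card ?X \<le> card (W \<rightarrow>\<^sub>E {..<Q})" using W by (intro card_mono) (auto simp: finite_PiE)
    then have X: "card ?X \<le> Q ^ card W" using W by (simp add: card_PiE)
    show ?thesis unfolding sum_constant using P X by (intro add_mono mult_right_mono) auto
  qed
  finally show ?thesis .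
qed

text \<open>If the claim failed, collisions, nonadjacent pairs and copies would each account for at
  most a quarter of the \<open>n ^ Q\<close> samples, which together do not exhaust them.\<close>

lemma supersaturation:
  assumes W: "finite W" and acyc: "acyclic R" and R: "R \<subseteq> W \<times> W"
    and Q: "Q = 2 ^ card W" and n: "4 * Q\<^sup>2 \<le> n"
    and few: "real (card {\<phi> \<in> embeddings W n. arc_image R \<phi> \<subseteq> D}) < real n ^ card W / (4 * real Q ^ card W)"
  shows "real n ^ 2 / (4 * real Q ^ 2) \<le> real (card (nonadjacent n D))"
proof (rule ccontr)
  assume neg: "\<not> ?thesis"
  define h where "h = card W"
  define e where "e = real (card {\<phi> \<in> embeddings W n. arc_image R \<phi> \<subseteq> D})"
  define M where "M = real (card (nonadjacent n D))"
  have Q1: "1 \<le> Q" and hQ: "h \<le> Q" using Q less_exp[of h] by (auto simp: h_def)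
  have n1: "0 < n" using n Q1 by (metis gr0I le_zero_eq mult_eq_0_iff not_one_le_zero power_not_zero zero_neq_numeral)
  have cnt: "real n ^ Q \<le> real Q ^ 2 * ((real n + M) * real n ^ (Q - 2)) + real Q ^ h * (e * real n ^ (Q - h))"
  proof -
    have "real (n ^ Q) \<le> real (Q\<^sup>2 * ((n + card (nonadjacent n D)) * n ^ (Q - 2)) +
     Q ^ card W * (card {\<phi> \<in> embeddings W n. arc_image R \<phi> \<subseteq> D} * n ^ (Q - card W)))"
      using supersaturation_count[OF W acyc R Q] of_nat_le_iff by blast
    then show ?thesis by (simp add: h_def e_def M_def)
  qed
  have "real Q ^ h * (e * real n ^ (Q - h)) < real Q ^ h * (real n ^ h / (4 * real Q ^ h) * real n ^ (Q - h))"
    using few Q1 n1 by (intro mult_strict_left_mono mult_strict_right_mono) (auto simp: e_def h_def)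
  also have "\<dots> = real n ^ (h + (Q - h)) / 4" using Q1 by (simp add: power_add)
  also have "\<dots> = real n ^ Q / 4" using hQ by simp
  finally have 1: "real Q ^ h * (e * real n ^ (Q - h)) < real n ^ Q / 4" .
  show False
  \<comment> \<open>Here truncated subtraction in \<open>Q - 2\<close> would spoil the exponents.
    But then \<open>W\<close> is empty, and the empty map alone contradicts
    \<open>few\<close>.\<close>
  proof (cases "Q = 1")
    case True
    then have "card W = 0" using Q by simp
    then have "W = {}" using W by simp
    then have "R = {}" using R by simp
    have "{\<phi> \<in> embeddings W n. arc_image R \<phi> \<subseteq> D} = {\<lambda>_. undefined}"
      using \<open>W = {}\<close> \<open>R = {}\<close> by (auto simp: embeddings_def arc_image_def)
    then have "e = 1" by (simp add: e_def)
    moreover have "e < 1 / 4" using few True \<open>card W = 0\<close> by (simp add: e_def)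
    ultimately show False by simp
  next
    case False
    then have Q2: "2 \<le> Q" using Q1 by simp
    have nn: "real n ^ Q = real n ^ 2 * real n ^ (Q - 2)" using Q2 by (metis le_add_diff_inverse power_add)
    have "M < real n ^ 2 / (4 * real Q ^ 2)" using neg by (simp add: M_def)
    then have "real Q ^ 2 * M < real n ^ 2 / 4" using Q1 by (simp add: field_simps)
    moreover have "real Q ^ 2 * real n \<le> real n ^ 2 / 4"
    proof -
      have "real (4 * Q\<^sup>2) \<le> real n" using n of_nat_le_iff by blast
      then have "4 * real Q ^ 2 * real n \<le> real n * real n" by (intro mult_right_mono) auto
      then show ?thesis by (simp add: power2_eq_square)
    qed
    ultimately have "real Q ^ 2 * (real n + M) \<le> real n ^ 2 / 2" by (simp add: algebra_simps)
    then have "real Q ^ 2 * (real n + M) * real n ^ (Q - 2) \<le> real n ^ 2 / 2 * real n ^ (Q - 2)"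
      by (intro mult_right_mono) auto
    then have "real Q ^ 2 * ((real n + M) * real n ^ (Q - 2)) \<le> real n ^ Q / 2"
      unfolding nn by (simp add: algebra_simps)
    moreover have "0 < real n ^ Q" using n1 by simp
    ultimately show False using cnt 1 by linarith
  qed
qed

section \<open>Containers for digraphs without a copy of an acyclic digraph\<close>

lemma card_Field_le: "finite J \<Longrightarrow> card (Field J) \<le> 2 * card J"
proof -
  assume J: "finite J"
  have "Field J = fst ` J \<union> snd ` J" by (auto simp: Field_def Domain_fst Range_snd)
  then have "card (Field J) \<le> card (fst ` J) + card (snd ` J)" by (metis card_Un_le)
  also have "\<dots> \<le> card J + card J" using J by (intro add_mono card_image_le)
  finally show ?thesis by simp
qed

text \<open>If a copy contains \<open>\<sigma>\<close>, then \<open>\<sigma>\<close> is the image of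
  some \<open>J \<subseteq> R\<close> of equal size. There are at most \<open>2 ^ card R\<close>
  such \<open>J\<close>; the vertices of \<open>J\<close> must go to endpoints of
  \<open>\<sigma>\<close>, boundedly many, and only the vertices outside \<open>Field J\<close>
  range over all \<open>n\<close> values.\<close>

lemma codegree_bounded_embeddings:
  assumes W: "finite W" and R: "R \<subseteq> W \<times> W" "irrefl R"
    and dens: "\<And>J. J \<subseteq> R \<Longrightarrow> J \<noteq> {} \<Longrightarrow>
      real n ^ (card W - card (Field J)) \<le> q ^ (card J - 1) * real n ^ card W / real n ^ 2"
    and q: "0 < q" and n: "0 < n"
  shows "codegree_bounded q (real n ^ card W) (real n ^ 2)
    (2 ^ card R * (2 * real (card R) + 1) ^ card W) (embeddings W n) (arc_image R)"
  unfolding codegree_bounded_def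
proof (intro allI impI)
  fix \<sigma> :: "(nat \<times> nat) set"
  assume \<sigma>: "finite \<sigma>" "\<sigma> \<noteq> {}"
  define h where "h = card W"
  \<comment> \<open>The summand 1 keeps the base positive, so that the exponent can be raised from
    \<open>card (Field J)\<close> to \<open>h\<close>.\<close>
  define k where "k = 2 * card R + 1"
  define x where "x = q ^ (card \<sigma> - 1) * real n ^ h / real n ^ 2"
  have finR: "finite R" using R(1) W finite_subset by blast
  let ?J = "{J. J \<subseteq> R \<and> J \<noteq> {} \<and> card J = card \<sigma>}"
  let ?X = "\<lambda>J. {\<phi> \<in> W \<rightarrow>\<^sub>E {..<n}. restrict \<phi> (Field J) \<in> Field J \<rightarrow>\<^sub>E Field \<sigma>}"
  have finJ: "finite ?J" using finR by simp
  have finX: "finite (?X J)" for J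
    by (rule finite_subset[OF _ finite_PiE[OF W, of "\<lambda>_. {..<n}"]]) auto
  have sub: "{\<phi> \<in> embeddings W n. \<sigma> \<subseteq> arc_image R \<phi>} \<subseteq> (\<Union>J\<in>?J. ?X J)"
  proof
    fix \<phi> assume "\<phi> \<in> {\<phi> \<in> embeddings W n. \<sigma> \<subseteq> arc_image R \<phi>}"
    then have \<phi>: "\<phi> \<in> W \<rightarrow>\<^sub>E {..<n}" "inj_on \<phi> W" "\<sigma> \<subseteq> map_prod \<phi> \<phi> ` R"
      by (auto simp: embeddings_def arc_image_def)
    define J where "J = {a \<in> R. map_prod \<phi> \<phi> a \<in> \<sigma>}"
    have im: "map_prod \<phi> \<phi> ` J = \<sigma>" 
    proof (intro subset_antisym subsetI)
      fix a assume "a \<in> \<sigma>"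
      moreover from this \<phi>(3) have "a \<in> map_prod \<phi> \<phi> ` R" by (rule rev_subsetD)
      then obtain b where "a = map_prod \<phi> \<phi> b" "b \<in> R" by (rule imageE)
      ultimately show "a \<in> map_prod \<phi> \<phi> ` J" by (simp add: J_def)
    qed (auto simp: J_def)
    have "inj_on (map_prod \<phi> \<phi>) J"
      by (rule inj_on_subset[OF map_prod_inj_on[OF \<phi>(2) \<phi>(2)]]) (use R(1) J_def in blast)
    then have "card J = card \<sigma>" using card_image im by metis
    moreover have "J \<noteq> {}" using im \<sigma>(2) by auto
    moreover have "J \<subseteq> R" by (auto simp: J_def)
    moreover have "\<phi> v \<in> Field \<sigma>" if v: "v \<in> Field J" for v
    proof -
      obtain w where "(v, w) \<in> J \<or> (w, v) \<in> J" using v unfolding Field_def by blast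
      then have "(\<phi> v, \<phi> w) \<in> \<sigma> \<or> (\<phi> w, \<phi> v) \<in> \<sigma>" by (auto simp: J_def)
      then show ?thesis by (auto simp: Field_def)
    qed
    ultimately show "\<phi> \<in> (\<Union>J\<in>?J. ?X J)" using \<phi>(1) by auto
  qed
  have "codegree (embeddings W n) (arc_image R) \<sigma> \<le> card (\<Union>J\<in>?J. ?X J)"
    unfolding codegree_def using finJ finX by (intro card_mono[OF _ sub]) simp
  also have "\<dots> \<le> (\<Sum>J\<in>?J. card (?X J))" by (rule card_UN_le[OF finJ])
  finally have "real (codegree (embeddings W n) (arc_image R) \<sigma>) \<le> (\<Sum>J\<in>?J. real (card (?X J)))"
    by (simp only: of_nat_sum[symmetric] of_nat_le_iff)
  also have "\<dots> \<le> (\<Sum>J\<in>?J. real k ^ h * x)"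
  proof (intro sum_mono)
    fix J assume J: "J \<in> ?J"
    have FJ: "Field J \<subseteq> W" using J R(1) by (auto simp: Field_def)
    have finFJ: "finite (Field J)" using FJ W finite_subset by blast
    have cFJ: "card (Field J) \<le> h" unfolding h_def using FJ W by (intro card_mono)
    have "card J \<le> card R" using J finR by (intro card_mono) auto
    then have "card \<sigma> \<le> card R" using J by simp
    then have F\<sigma>: "card (Field \<sigma>) \<le> k" using card_Field_le[OF \<sigma>(1)] by (simp add: k_def)
    have "card (?X J) \<le> card (Field J \<rightarrow>\<^sub>E Field \<sigma>) * card {..<n} ^ (card W - card (Field J))"
    proof (rule card_determined_le[OF W FJ])
      show "finite (Field J \<rightarrow>\<^sub>E Field \<sigma>)" using finFJ \<sigma>(1) by (intro finite_PiE) (auto simp: finite_Field)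
      fix f f' :: "'a \<Rightarrow> nat" and v assume "restrict f (Field J) = restrict f' (Field J)" "v \<in> Field J"
      then show "f v = f' v" by (metis restrict_apply')
    qed simp
    also have "\<dots> = card (Field \<sigma>) ^ card (Field J) * n ^ (h - card (Field J))"
      using finFJ by (simp add: card_PiE h_def)
    also have "\<dots> \<le> k ^ h * n ^ (h - card (Field J))"
    proof (intro mult_right_mono)
      have "card (Field \<sigma>) ^ card (Field J) \<le> k ^ card (Field J)" using F\<sigma> by (rule power_mono) simp
      also have "\<dots> \<le> k ^ h" using cFJ by (intro power_increasing) (auto simp: k_def)
      finally show "card (Field \<sigma>) ^ card (Field J) \<le> k ^ h" .
    qed simp
    finally have "real (card (?X J)) \<le> real (k ^ h * n ^ (h - card (Field J)))" using of_nat_le_iff by blast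
    also have "\<dots> = real k ^ h * real n ^ (h - card (Field J))" by simp
    also have "\<dots> \<le> real k ^ h * x"
      using dens[of J] J unfolding h_def x_def by (intro mult_left_mono) auto
    finally show "real (card (?X J)) \<le> real k ^ h * x" .
  qed
  also have "\<dots> = real (card ?J) * (real k ^ h * x)" by simp
  also have "\<dots> \<le> 2 ^ card R * (real k ^ h * x)"
  proof (intro mult_right_mono)
    have "card ?J \<le> card (Pow R)" using finR by (intro card_mono) auto
    then have "card ?J \<le> 2 ^ card R" using finR by (simp add: card_Pow)
    then have "real (card ?J) \<le> real (2 ^ card R)" using of_nat_le_iff by blast
    then show "real (card ?J) \<le> 2 ^ card R" by simp
  qed (use q in \<open>simp add: x_def\<close>)
  finally show "real (codegree (embeddings W n) (arc_image R) \<sigma>)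
      \<le> 2 ^ card R * (2 * real (card R) + 1) ^ card W * q ^ (card \<sigma> - 1) * real n ^ card W / real n ^ 2"
    by (simp add: x_def k_def h_def algebra_simps)
qed

text \<open>The container theorem is used with \<open>n ^ 2\<close> as vertex scale and
  \<open>n ^ card W\<close> as edge scale. Densities enter only through \<open>dens\<close>, which
  is the codegree requirement stripped of constants.\<close>

lemma digraph_containers:
  assumes W: "finite W" and acyc: "acyclic R" and R: "R \<subseteq> W \<times> W"
    and q0: "q \<longlonglongrightarrow> 0" and qpos: "\<forall>\<^sub>F n in sequentially. 0 < q n"
    and qn: "\<forall>\<^sub>F n in sequentially. 1 \<le> q n * real n ^ 2"
    and dens: "\<forall>\<^sub>F n in sequentially. \<forall>J. J \<subseteq> R \<longrightarrow> J \<noteq> {} \<longrightarrow>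
      real n ^ (card W - card (Field J)) \<le> q n ^ (card J - 1) * real n ^ card W / real n ^ 2"
  shows "\<exists>K c :: real. 0 \<le> K \<and> 0 < c \<and> (\<forall>\<^sub>F n in sequentially.
    \<exists>f. container_map (embeddings W n) (arc_image R) (all_arcs n) (K * q n * real n ^ 2)
      (\<lambda>C. c * real n ^ 2 \<le> real (card (nonadjacent n C))) f)"
proof -
  define Q :: nat where "Q = 2 ^ card W"
  \<comment> \<open>This is the threshold for copies in \<open>supersaturation\<close>.\<close>
  define \<epsilon> where "\<epsilon> = 1 / (4 * real Q ^ card W)"
  define b where "b = 2 ^ card R * (2 * real (card R) + 1) ^ card W"
  have \<epsilon>: "0 < \<epsilon>" and b: "0 < b" by (auto simp: \<epsilon>_def Q_def b_def add_nonneg_pos)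
  have irr: "irrefl R" using acyc by (auto simp: irrefl_def acyclic_def)
  obtain K p0 where Kp0: "0 \<le> K \<and> 0 < p0 \<and>
    (\<forall>(A :: ('a \<Rightarrow> nat) set) r (V :: (nat \<times> nat) set) N p E.
       finite V \<longrightarrow> real (card V) \<le> N \<longrightarrow> 0 < p \<longrightarrow> p \<le> p0 \<longrightarrow> 1 \<le> p * N \<longrightarrow> 0 < E \<longrightarrow>
       uniform_on V (card R) A r \<longrightarrow> codegree_bounded p E N b A r \<longrightarrow>
       (\<exists>f. container_map A r V (K * p * N) (\<lambda>C. real (card {e \<in> A. r e \<subseteq> C}) < \<epsilon> * E) f))"
    using containers[OF \<epsilon> b, where 'i = "'a \<Rightarrow> nat" and 'v = "nat \<times> nat", of "card R"] by (elim exE)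
  then have K: "0 \<le> K" "0 < p0" by blast+
  note cont = Kp0[THEN conjunct2, THEN conjunct2, rule_format]
  have "\<forall>\<^sub>F n in sequentially. q n < p0" using q0 K(2) by (rule order_tendstoD)
  moreover have "\<forall>\<^sub>F n in sequentially. 4 * Q\<^sup>2 + 1 \<le> n" by (rule eventually_ge_at_top)
  ultimately have "\<forall>\<^sub>F n in sequentially.
    \<exists>f. container_map (embeddings W n) (arc_image R) (all_arcs n) (K * q n * real n ^ 2)
      (\<lambda>C. 1 / (4 * real Q ^ 2) * real n ^ 2 \<le> real (card (nonadjacent n C))) f"
    using qpos qn dens
  proof eventually_elim
    case (elim n)
    have n: "4 * Q\<^sup>2 \<le> n" "0 < n" using elim by auto
    have "codegree_bounded (q n) (real n ^ card W) (real n ^ 2) b (embeddings W n) (arc_image R)"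
      unfolding b_def using elim n by (intro codegree_bounded_embeddings W R irr) auto
    moreover have "uniform_on (all_arcs n) (card R) (embeddings W n) (arc_image R)"
      unfolding uniform_on_def using finite_embeddings[OF W] arc_image_embedding[OF _ R irr] by blast
    moreover have "real (card (all_arcs n)) \<le> real n ^ 2"
      using card_all_arcs_le[of n] by (metis of_nat_le_iff of_nat_power)
    ultimately have "\<exists>f. container_map (embeddings W n) (arc_image R) (all_arcs n) (K * q n * real n ^ 2)
      (\<lambda>C. real (card {\<phi> \<in> embeddings W n. arc_image R \<phi> \<subseteq> C}) < \<epsilon> * real n ^ card W) f"
      using elim n by (intro cont finite_all_arcs) auto
    then obtain f where f: "container_map (embeddings W n) (arc_image R) (all_arcs n) (K * q n * real n ^ 2)
      (\<lambda>C. real (card {\<phi> \<in> embeddings W n. arc_image R \<phi> \<subseteq> C}) < \<epsilon> * real n ^ card W) f" by blast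
    have "1 / (4 * real Q ^ 2) * real n ^ 2 \<le> real (card (nonadjacent n C))"
      if "real (card {\<phi> \<in> embeddings W n. arc_image R \<phi> \<subseteq> C}) < \<epsilon> * real n ^ card W" for C
      using supersaturation[OF W acyc R Q_def n(1), of C] that by (simp add: \<epsilon>_def)
    then show ?case by (intro exI, rule container_map_mono[OF f])
  qed
  then show ?thesis
    by - (rule exI[of _ K], rule exI[of _ "1 / (4 * real Q ^ 2)"], use K in \<open>simp add: Q_def\<close>)
qed

section \<open>Union bound over fingerprints\<close>

text \<open>The absence of opposite arcs is recorded because it passes to fingerprints, where it
  makes the number of required edges equal to the number of arcs.\<close>

definition avoiding :: "'i set \<Rightarrow> ('i \<Rightarrow> (nat \<times> nat) set) \<Rightarrow> nat \<Rightarrow> (nat \<times> nat) set set" where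
  "avoiding A r n = {I. I \<subseteq> all_arcs n \<and> stable A r I \<and> (\<forall>(u, v)\<in>I. (v, u) \<notin> I)}"

definition edges_of :: "(nat \<times> nat) set \<Rightarrow> nat set set" where
  "edges_of S = (\<lambda>(u, v). {u, v}) ` S"

definition all_edges :: "nat \<Rightarrow> nat set set" where
  "all_edges n = {e. e \<subseteq> {..<n} \<and> card e = 2}"

lemma finite_all_edges: "finite (all_edges n)"
  unfolding all_edges_def by (rule finite_subset[of _ "Pow {..<n}"]) auto

lemma edges_of_subset: "S \<subseteq> all_arcs n \<Longrightarrow> edges_of S \<subseteq> all_edges n"
  by (auto simp: edges_of_def all_arcs_def all_edges_def)

lemma card_edges_of_antisym:
  assumes "\<forall>(u, v)\<in>S. (v, u) \<notin> S"
  shows "card (edges_of S) = card S"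
  unfolding edges_of_def
proof (intro card_image inj_onI)
  fix a b assume ab: "a \<in> S" "b \<in> S" "(\<lambda>(u, v). {u, v}) a = (\<lambda>(u, v). {u, v}) b"
  obtain u v u' v' where uv: "a = (u, v)" "b = (u', v')" by fastforce
  have "(u = u' \<and> v = v') \<or> (u = v' \<and> v = u')" using ab(3) by (simp add: uv doubleton_eq_iff)
  then show "a = b" using ab(1,2) assms unfolding uv by blast
qed

lemma card_le_edges_of:
  assumes "finite S"
  shows "card S \<le> 2 * card (edges_of S)"
proof -
  have "card {a \<in> S. (\<lambda>(u, v). {u, v}) a = e} \<le> 2" if "e \<in> edges_of S" for e
  proof -
    obtain u v where e: "e = {u, v}" using \<open>e \<in> edges_of S\<close> by (auto simp: edges_of_def)
    have "{a \<in> S. (\<lambda>(u, v). {u, v}) a = e} \<subseteq> {(u, v), (v, u)}"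
    proof
      fix a assume a: "a \<in> {a \<in> S. (\<lambda>(u, v). {u, v}) a = e}"
      obtain x y where "a = (x, y)" by fastforce
      then show "a \<in> {(u, v), (v, u)}" using a e by (simp add: doubleton_eq_iff)
    qed
    then have "card {a \<in> S. (\<lambda>(u, v). {u, v}) a = e} \<le> card {(u, v), (v, u)}" by (intro card_mono) auto
    also have "\<dots> \<le> 2" using card_length[of "[(u, v), (v, u)]"] by simp
    finally show ?thesis .
  qed
  then have "(\<Sum>e\<in>edges_of S. card {a \<in> S. (\<lambda>(u, v). {u, v}) a = e}) \<le> (\<Sum>e\<in>edges_of S. 2)"
    by (rule sum_mono)
  moreover have "card S = (\<Sum>e\<in>edges_of S. card {a \<in> S. (\<lambda>(u, v). {u, v}) a = e})"
    using assms unfolding edges_of_def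
    using sum.group[of S "(\<lambda>(u, v). {u, v}) ` S" "\<lambda>(u, v). {u, v}" "\<lambda>_. 1::nat"] by simp
  ultimately show ?thesis by simp
qed

section \<open>Probability estimates\<close>

lemma prob_edges_le:
  assumes p: "0 \<le> p" "p \<le> 1" and S: "S \<subseteq> all_edges n" and M: "M \<subseteq> all_edges n" and disj: "S \<inter> M = {}"
  shows "measure_pmf.prob (Pi_pmf (all_edges n) False (\<lambda>_. bernoulli_pmf p))
      {f. (\<forall>e\<in>S. f e) \<and> (\<forall>e\<in>M. \<not> f e)} \<le> p ^ card S * exp (- p * real (card M))"
proof -
  define B where "B e = (if e \<in> S then {True} else if e \<in> M then {False} else UNIV)" for e
  have fin: "finite (all_edges n)" by (rule finite_all_edges)
  have finSM: "finite S" "finite M" using S M fin finite_subset by blast+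
  have "measure_pmf.prob (Pi_pmf (all_edges n) False (\<lambda>_. bernoulli_pmf p))
      {f. (\<forall>e\<in>S. f e) \<and> (\<forall>e\<in>M. \<not> f e)} \<le>
      measure_pmf.prob (Pi_pmf (all_edges n) False (\<lambda>_. bernoulli_pmf p)) (Pi (all_edges n) B)"
    by (rule measure_pmf.finite_measure_mono) (auto simp: B_def)
  also have "\<dots> = (\<Prod>e\<in>all_edges n. measure_pmf.prob (bernoulli_pmf p) (B e))"
    by (rule measure_Pi_pmf_Pi[OF fin])
  also have "\<dots> = (\<Prod>e\<in>all_edges n. (if e \<in> S then p else 1) * (if e \<in> M then 1 - p else 1))"
    using p disj by (intro prod.cong refl) (auto simp: B_def measure_pmf_single)
  also have "\<dots> = (\<Prod>e\<in>all_edges n. if e \<in> S then p else 1) * (\<Prod>e\<in>all_edges n. if e \<in> M then 1 - p else 1)"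
    by (rule prod.distrib)
  also have "\<dots> = p ^ card S * (1 - p) ^ card M"
    using S M fin by (simp add: prod.If_cases Int_absorb1 Int_absorb2)
  also have "\<dots> \<le> p ^ card S * exp (- p) ^ card M"
  proof (intro mult_left_mono power_mono)
    show "1 - p \<le> exp (- p)" using exp_ge_add_one_self[of "- p"] by simp
  qed (use p in auto)
  also have "exp (- p) ^ card M = exp (- p * real (card M))" by (simp add: exp_of_nat_mult[symmetric] mult.commute)
  finally show ?thesis .
qed

lemma sum_power_card_Pow:
  fixes y :: real
  assumes "finite V"
  shows "(\<Sum>S\<in>Pow V. y ^ card S) = (1 + y) ^ card V"
  using prod_add[OF assms, of "\<lambda>_. y" "\<lambda>_. 1"] by (simp add: add.commute[of y 1])

text \<open>
  The weight \<open>x ^ card S\<close>, at least \<open>x powr k\<close> on the family, makes the sum extend to all of \<open>Pow V\<close> at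
  the cost of a factor \<open>x powr (- k)\<close>.
\<close>

lemma sum_small_sets_le:
  fixes x p k :: real
  assumes V: "finite V" and x: "0 < x" "x \<le> 1" and p: "0 \<le> p"
    and F: "F \<subseteq> Pow V" "\<And>S. S \<in> F \<Longrightarrow> real (card S) \<le> k"
  shows "(\<Sum>S\<in>F. p ^ card S) \<le> exp (k * ln (1 / x) + x * p * real (card V))"
proof -
  have "(\<Sum>S\<in>F. p ^ card S) \<le> (\<Sum>S\<in>F. exp (k * ln (1 / x)) * (x * p) ^ card S)"
  proof (intro sum_mono)
    fix S assume "S \<in> F"
    then have "real (card S) * ln (1 / x) \<le> k * ln (1 / x)"
      using F(2) x by (intro mult_right_mono) (auto simp: ln_div)
    then have "exp (real (card S) * ln (1 / x)) \<le> exp (k * ln (1 / x))" by simp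
    moreover have "exp (real (card S) * ln (1 / x)) = (1 / x) ^ card S"
      using x by (simp add: exp_of_nat_mult)
    ultimately have "(1 / x) ^ card S * (x * p) ^ card S \<le> exp (k * ln (1 / x)) * (x * p) ^ card S"
      using x p by (intro mult_right_mono) auto
    moreover have "(1 / x) ^ card S * (x * p) ^ card S = p ^ card S"
      using x by (simp add: power_mult_distrib[symmetric])
    ultimately show "p ^ card S \<le> exp (k * ln (1 / x)) * (x * p) ^ card S" by simp
  qed
  also have "\<dots> = exp (k * ln (1 / x)) * (\<Sum>S\<in>F. (x * p) ^ card S)" by (simp add: sum_distrib_left)
  also have "\<dots> \<le> exp (k * ln (1 / x)) * (\<Sum>S\<in>Pow V. (x * p) ^ card S)"
    using V F(1) x p by (intro mult_left_mono sum_mono2) auto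
  also have "(\<Sum>S\<in>Pow V. (x * p) ^ card S) = (1 + x * p) ^ card V" by (rule sum_power_card_Pow[OF V])
  also have "\<dots> \<le> exp (x * p) ^ card V"
    using x p by (intro power_mono) (auto simp: exp_ge_add_one_self)
  also have "exp (x * p) ^ card V = exp (x * p * real (card V))"
    by (simp add: exp_of_nat_mult[symmetric] mult.commute)
  finally show ?thesis by (simp add: exp_add)
qed

text \<open>The union runs over fingerprints \<open>S\<close> only, since \<open>f S\<close> returns
  the container. Pairs nonadjacent in the container are nonadjacent in \<open>I\<close>, hence
  absent. The half in the exponent arises because \<open>nonadjacent\<close> lists each pair in both
  orders.\<close>

lemma prob_avoiding_le:
  fixes p x k c :: real
  assumes f: "container_map A r (all_arcs n) k (\<lambda>C. c * real n ^ 2 \<le> real (card (nonadjacent n C))) f"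
    and p: "0 \<le> p" "p \<le> 1" and x: "0 < x" "x \<le> 1"
  shows "measure_pmf.prob (Pi_pmf (all_edges n) False (\<lambda>_. bernoulli_pmf p))
     {g. \<exists>I\<in>avoiding A r n. (\<forall>e\<in>edges_of I. g e) \<and> (\<forall>e\<in>edges_of (nonadjacent n I). \<not> g e)}
     \<le> exp (k * ln (1 / x) + x * p * real n ^ 2 - p * c * real n ^ 2 / 2)"
    (is "measure_pmf.prob ?P ?Ev \<le> _")
proof -
  define F where "F = (\<lambda>I. fst (f I)) ` avoiding A r n"
  let ?E = "\<lambda>S. {g. (\<forall>e\<in>edges_of S. g e) \<and> (\<forall>e\<in>edges_of (nonadjacent n (snd (f S))). \<not> g e)}"
  have fp: "fingerprinting f" by (rule container_mapD(1)[OF f])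
  have I: "fst (f I) \<subseteq> I" "f (fst (f I)) = f I" "I \<subseteq> snd (f I)" "real (card (fst (f I))) \<le> k"
    "c * real n ^ 2 \<le> real (card (nonadjacent n (snd (f I))))" if "I \<in> avoiding A r n" for I
  proof -
    have "I \<subseteq> all_arcs n" "stable A r I" using that by (auto simp: avoiding_def)
    from container_mapD(2)[OF f this] show "I \<subseteq> snd (f I)" "real (card (fst (f I))) \<le> k"
      "c * real n ^ 2 \<le> real (card (nonadjacent n (snd (f I))))" by auto
    show "fst (f I) \<subseteq> I" using fp unfolding fingerprinting_def by blast
    then show "f (fst (f I)) = f I" using fp unfolding fingerprinting_def by blast
  qed
  have FV: "F \<subseteq> Pow (all_arcs n)" using I(1) unfolding F_def avoiding_def by blast
  then have finF: "finite F" using finite_all_arcs finite_subset by blast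
  have "?Ev \<subseteq> (\<Union>S\<in>F. ?E S)"
  proof
    fix g assume "g \<in> ?Ev"
    then obtain J where J: "J \<in> avoiding A r n" "\<forall>e\<in>edges_of J. g e" "\<forall>e\<in>edges_of (nonadjacent n J). \<not> g e"
      by blast
    have "edges_of (fst (f J)) \<subseteq> edges_of J" using I(1)[OF J(1)] by (auto simp: edges_of_def)
    moreover have "edges_of (nonadjacent n (snd (f J))) \<subseteq> edges_of (nonadjacent n J)"
      unfolding edges_of_def using I(3)[OF J(1)] by (intro image_mono) (auto simp: nonadjacent_def)
    ultimately have "g \<in> ?E (fst (f J))" using J(2,3) I(2)[OF J(1)] by auto
    then show "g \<in> (\<Union>S\<in>F. ?E S)" using J(1) by (auto simp: F_def)
  qed
  then have "measure_pmf.prob ?P ?Ev \<le> measure_pmf.prob ?P (\<Union>S\<in>F. ?E S)"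
    by (intro measure_pmf.finite_measure_mono) auto
  also have "\<dots> \<le> (\<Sum>S\<in>F. measure_pmf.prob ?P (?E S))"
    using finF by (intro measure_pmf.finite_measure_subadditive_finite) auto
  also have "\<dots> \<le> (\<Sum>S\<in>F. p ^ card S * exp (- p * c * real n ^ 2 / 2))"
  proof (intro sum_mono)
    fix S assume "S \<in> F"
    then obtain J where J: "J \<in> avoiding A r n" "S = fst (f J)" by (auto simp: F_def)
    note IJ = I[OF J(1)]
    let ?M = "nonadjacent n (snd (f S))"
    have SJ: "S \<subseteq> J" "f S = f J" using IJ J(2) by auto
    have SV: "S \<subseteq> all_arcs n" using SJ J(1) by (auto simp: avoiding_def)
    have asym: "\<forall>(u, v)\<in>S. (v, u) \<notin> S" 
    proof -
      have "\<forall>(u, v)\<in>J. (v, u) \<notin> J" using J(1) by (simp add: avoiding_def)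
      then show ?thesis using SJ(1) by blast
    qed
    have MV: "?M \<subseteq> all_arcs n" by (auto simp: nonadjacent_def)
    \<comment> \<open>The container includes its fingerprint, so the edges required and those
      forbidden are disjoint and the two factors multiply.\<close>
    have "S \<subseteq> snd (f S)" using SJ IJ(3) by auto
    then have disj: "edges_of S \<inter> edges_of ?M = {}"
      unfolding edges_of_def nonadjacent_def by (fastforce simp: doubleton_eq_iff)
    have "measure_pmf.prob ?P (?E S) \<le> p ^ card (edges_of S) * exp (- p * real (card (edges_of ?M)))"
      by (intro prob_edges_le p disj edges_of_subset SV MV)
    also have "card (edges_of S) = card S" by (rule card_edges_of_antisym[OF asym])
    also have "p ^ card S * exp (- p * real (card (edges_of ?M))) \<le> p ^ card S * exp (- p * c * real n ^ 2 / 2)"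
    proof (intro mult_left_mono)
      have "card ?M \<le> 2 * card (edges_of ?M)" by (rule card_le_edges_of[OF finite_nonadjacent])
      then have "c * real n ^ 2 / 2 \<le> real (card (edges_of ?M))" using IJ(5) SJ(2) by simp
      then have "p * (c * real n ^ 2 / 2) \<le> p * real (card (edges_of ?M))" using p(1) by (rule mult_left_mono)
      then show "exp (- p * real (card (edges_of ?M))) \<le> exp (- p * c * real n ^ 2 / 2)" by simp
    qed (use p in auto)
    finally show "measure_pmf.prob ?P (?E S) \<le> p ^ card S * exp (- p * c * real n ^ 2 / 2)" .
  qed
  also have "\<dots> = (\<Sum>S\<in>F. p ^ card S) * exp (- p * c * real n ^ 2 / 2)" by (simp add: sum_distrib_right)
  also have "\<dots> \<le> exp (k * ln (1 / x) + x * p * real (card (all_arcs n))) * exp (- p * c * real n ^ 2 / 2)"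
    using I(4) by (intro mult_right_mono sum_small_sets_le finite_all_arcs x p FV) (auto simp: F_def)
  also have "\<dots> \<le> exp (k * ln (1 / x) + x * p * real n ^ 2) * exp (- p * c * real n ^ 2 / 2)"
  proof (intro mult_right_mono)
    have "real (card (all_arcs n)) \<le> real n ^ 2"
      using card_all_arcs_le[of n] by (metis of_nat_le_iff of_nat_power)
    then have "x * p * real (card (all_arcs n)) \<le> x * p * real n ^ 2"
      using x p by (intro mult_left_mono) auto
    then show "exp (k * ln (1 / x) + x * p * real (card (all_arcs n))) \<le> exp (k * ln (1 / x) + x * p * real n ^ 2)"
      by simp
  qed simp
  also have "\<dots> = exp (k * ln (1 / x) + x * p * real n ^ 2 - p * c * real n ^ 2 / 2)"
    by (simp add: exp_add[symmetric])
  finally show ?thesis .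
qed

section \<open>Oriented graphs and the maximum 2-density\<close>

lemma oriented_graphD:
  assumes "oriented_graph H"
  shows "finite (pverts H)" "parcs H \<subseteq> pverts H \<times> pverts H" "\<forall>(u, v)\<in>parcs H. (v, u) \<notin> parcs H"
    "irrefl (parcs H)"
proof -
  obtain G where G: "pair_graph G" "orientation G H" using assms by (auto simp: oriented_graph_def)
  interpret pair_graph G by (rule G(1))
  have H: "pverts H = pverts G" "parcs H \<subseteq> parcs G"
    and asym: "\<And>u v. (u, v) \<in> parcs G \<Longrightarrow> ((u, v) \<in> parcs H) \<noteq> ((v, u) \<in> parcs H)"
    using G(2) by (auto simp: orientation_def)
  show "finite (pverts H)" using H(1) pair_finite_verts by simp
  show "parcs H \<subseteq> pverts H \<times> pverts H"
    using H wellformed' by auto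
  show asymH: "\<forall>(u, v)\<in>parcs H. (v, u) \<notin> parcs H" using asym H(2) by blast
  then show "irrefl (parcs H)" by (auto simp: irrefl_def)
qed

text \<open>A pair in the transitive closure yields a nonempty closed walk, and such a walk contains
  a cycle.\<close>

lemma acyclic_parcs:
  assumes "acyclically_oriented H"
  shows "acyclic (parcs H)"
proof (rule acyclicI, intro allI notI)
  fix x assume x: "(x, x) \<in> (parcs H)\<^sup>+"
  have sub: "parcs H \<subseteq> pverts H \<times> pverts H" and nocyc: "\<not> (\<exists>c. pre_digraph.cycle (with_proj H) c)"
    using assms oriented_graphD(2) by (auto simp: acyclically_oriented_def)
  interpret wf_digraph "with_proj H" by unfold_locales (use sub in auto)
  obtain p where "awalk x p x" "p \<noteq> []" using x reachable1_awalk[of x x] by auto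
  then have "closed_w p" by (auto simp: closed_w_def)
  then show False using closed_w_imp_cycle nocyc by blast
qed

lemma contains_copyI:
  assumes H: "parcs H \<subseteq> pverts H \<times> pverts H" and D: "parcs D \<subseteq> pverts D \<times> pverts D"
    and \<phi>: "inj_on \<phi> (pverts H)" "\<phi> ` pverts H \<subseteq> pverts D" "map_prod \<phi> \<phi> ` parcs H \<subseteq> parcs D"
  shows "contains_copy D H"
proof -
  define D' where "D' = \<lparr>pverts = \<phi> ` pverts H, parcs = map_prod \<phi> \<phi> ` parcs H\<rparr>"
  define h where "h = \<lparr>iso_verts = \<phi>, iso_arcs = map_prod \<phi> \<phi>, iso_head = snd, iso_tail = fst\<rparr>"
  have wfH: "wf_digraph (with_proj H)" by unfold_locales (use H in auto)
  have "wf_digraph (with_proj D)" by unfold_locales (use D in auto)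
  moreover have "wf_digraph (with_proj D')" by unfold_locales (use H in \<open>auto simp: D'_def\<close>)
  ultimately have "subgraph (with_proj D') (with_proj D)"
    using \<phi>(2,3) by (simp add: subgraph_def compatible_def D'_def)
  moreover have "inj_on (map_prod \<phi> \<phi>) (parcs H)"
    by (rule inj_on_subset[OF map_prod_inj_on[OF \<phi>(1) \<phi>(1)] H])
  then have "pre_digraph.digraph_isomorphism (with_proj H) h"
    using \<phi>(1) wfH by (simp add: pre_digraph.digraph_isomorphism_def h_def)
  moreover have "with_proj D' = app_iso h (with_proj H)"
    by (simp add: app_iso_def with_proj_def D'_def h_def)
  ultimately show ?thesis unfolding contains_copy_def digraph_iso_def by blast
qed

text \<open>The arc set is symmetrised to a graph on \<open>Field J\<close>, one of the finitely
  many subgraphs in the maximum. As \<open>H\<close> has no opposite arcs, this graph has exactly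
  \<open>card J\<close> edges.\<close>

lemma rho2_le_m2_oriented:
  assumes H: "finite (pverts H)" "parcs H \<subseteq> pverts H \<times> pverts H" "\<forall>(u, v)\<in>parcs H. (v, u) \<notin> parcs H"
    and J: "J \<subseteq> parcs H" "3 \<le> card (Field J)"
  shows "(real (card J) - 1) / (real (card (Field J)) - 2) \<le> m2_oriented H"
proof -
  let ?G = "mk_symmetric (with_proj H)"
  define J' where "J' = \<lparr>pverts = Field J, parcs = J \<union> J\<inverse>\<rparr>"
  have FJ: "Field J \<subseteq> pverts H" using J(1) H(2) by (auto simp: Field_def)
  then have finFJ: "finite (Field J)" using H(1) finite_subset by blast
  have irr: "(u, u) \<notin> parcs H" for u using H(3) by blast
  have finJ: "finite J" using J(1) H(1,2) by (meson finite_SigmaI finite_subset)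
  have arcsG: "parcs ?G = parcs H \<union> (parcs H)\<inverse>" by (auto simp: parcs_mk_symmetric)
  have wfJ: "pair_wf_digraph J'" by unfold_locales (auto simp: J'_def Field_def)
  have "pair_graph J'"
  proof -
    interpret pair_wf_digraph J' by (rule wfJ)
    show ?thesis
      by unfold_locales (use finFJ finJ irr J(1) in \<open>auto simp: J'_def symmetric_def sym_def\<close>)
  qed
  moreover have "pair_wf_digraph ?G"
    by unfold_locales (use H(2) in \<open>auto simp: arcsG\<close>)
  then have "subgraph (with_proj J') (with_proj ?G)"
    unfolding subgraph_def using wfJ FJ J(1)
    by (auto simp: wf_digraph_wp_iff compatible_def arcsG J'_def)
  moreover have "pverts J' \<noteq> {}" using J(2) by (auto simp: J'_def)
  ultimately have mem: "rho2 J' \<in> {rho2 J | J. pair_graph J \<and> subgraph (with_proj J) (with_proj ?G) \<and> pverts J \<noteq> {}}"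
    by blast
  have "finite {J. subgraph (with_proj J) (with_proj ?G)}"
  proof (rule finite_subset)
    show "{J. subgraph (with_proj J) (with_proj ?G)} \<subseteq>
        (\<lambda>(V, E). \<lparr>pverts = V, parcs = E\<rparr>) ` (Pow (pverts H) \<times> Pow (pverts H \<times> pverts H))"
    proof
      fix K assume "K \<in> {J. subgraph (with_proj J) (with_proj ?G)}"
      then have "pverts K \<subseteq> pverts H" "parcs K \<subseteq> pverts H \<times> pverts H"
        using H(2) by (auto simp: subgraph_def arcsG)
      moreover have "K = (\<lambda>(V, E). \<lparr>pverts = V, parcs = E\<rparr>) (pverts K, parcs K)" by simp
      ultimately show "K \<in> (\<lambda>(V, E). \<lparr>pverts = V, parcs = E\<rparr>) ` (Pow (pverts H) \<times> Pow (pverts H \<times> pverts H))"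
        by blast
    qed
    show "finite ((\<lambda>(V, E). \<lparr>pverts = V, parcs = E\<rparr>) ` (Pow (pverts H) \<times> Pow (pverts H \<times> pverts H)))"
      using H(1) by simp
  qed
  then have "finite (rho2 ` {J. subgraph (with_proj J) (with_proj ?G)})" by (rule finite_imageI)
  then have "finite {rho2 J | J. pair_graph J \<and> subgraph (with_proj J) (with_proj ?G) \<and> pverts J \<noteq> {}}"
    by (rule finite_subset[rotated]) blast
  then have "rho2 J' \<le> m2_oriented H"
    unfolding m2_oriented_def m2_def using mem by (rule Max_ge)
  moreover have "num_edges J' = card J"
  proof -
    have "(\<lambda>(u, v). {u, v}) ` parcs J' = (\<lambda>(u, v). {u, v}) ` J"
      by (auto simp: J'_def image_def)
    moreover have "inj_on (\<lambda>(u, v). {u, v}) J"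
    proof (rule inj_onI)
      fix a b assume ab: "a \<in> J" "b \<in> J" "(\<lambda>(u, v). {u, v}) a = (\<lambda>(u, v). {u, v}) b"
      obtain u v u' v' where uv: "a = (u, v)" "b = (u', v')" by fastforce
      have "(u = u' \<and> v = v') \<or> (u = v' \<and> v = u')" using ab(3) by (simp add: uv doubleton_eq_iff)
      then show "a = b" using ab(1,2) H(3) J(1) unfolding uv by blast
    qed
    ultimately show ?thesis unfolding num_edges_def by (simp add: card_image)
  qed
  ultimately show ?thesis using J(2) by (simp add: rho2_def num_verts_def J'_def)
qed

section \<open>The threshold\<close>

text \<open>The arcs of an orientation without a copy serve as \<open>I\<close>. Each edge of the
  graph is oriented one way, so a pair without an arc is not an edge.\<close>

lemma avoiding_of_not_arrows:
  fixes H :: "'a pair_pre_digraph" and g :: "nat set \<Rightarrow> bool"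
  assumes H: "parcs H \<subseteq> pverts H \<times> pverts H"
    and G: "\<not> arrows \<lparr>pverts = {..<n}, parcs = {(u, v). u < n \<and> v < n \<and> u \<noteq> v \<and> g {u, v}}\<rparr> H"
  shows "\<exists>I\<in>avoiding (embeddings (pverts H) n) (arc_image (parcs H)) n.
    (\<forall>e\<in>edges_of I. g e) \<and> (\<forall>e\<in>edges_of (nonadjacent n I). \<not> g e)"
proof -
  obtain D where D: "orientation \<lparr>pverts = {..<n}, parcs = {(u, v). u < n \<and> v < n \<and> u \<noteq> v \<and> g {u, v}}\<rparr> D"
    and no: "\<not> contains_copy D H"
    using G by (auto simp: arrows_def)
  have DV: "pverts D = {..<n}" and sub: "\<And>u v. (u, v) \<in> parcs D \<Longrightarrow> u < n \<and> v < n \<and> u \<noteq> v \<and> g {u, v}"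
    and dir: "\<And>u v. u < n \<Longrightarrow> v < n \<Longrightarrow> u \<noteq> v \<Longrightarrow> g {u, v} \<Longrightarrow> ((u, v) \<in> parcs D) \<noteq> ((v, u) \<in> parcs D)"
    using D unfolding orientation_def by auto
  have arcs: "parcs D \<subseteq> all_arcs n" using sub by (auto simp: all_arcs_def)
  have "stable (embeddings (pverts H) n) (arc_image (parcs H)) (parcs D)"
    unfolding stable_def
  proof (intro ballI notI)
    fix \<phi> assume \<phi>: "\<phi> \<in> embeddings (pverts H) n" "arc_image (parcs H) \<phi> \<subseteq> parcs D"
    have "contains_copy D H"
    proof (rule contains_copyI[OF H])
      show "parcs D \<subseteq> pverts D \<times> pverts D" using sub DV by auto
      show "\<phi> ` pverts H \<subseteq> pverts D" using \<phi>(1) DV by (auto simp: embeddings_def)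
    qed (use \<phi> in \<open>auto simp: embeddings_def arc_image_def\<close>)
    then show False using no by simp
  qed
  moreover have "\<forall>(u, v)\<in>parcs D. (v, u) \<notin> parcs D"
    using sub dir by blast
  ultimately have "parcs D \<in> avoiding (embeddings (pverts H) n) (arc_image (parcs H)) n"
    using arcs by (simp add: avoiding_def)
  moreover have "\<forall>e\<in>edges_of (parcs D). g e" using sub by (auto simp: edges_of_def)
  moreover have "\<forall>e\<in>edges_of (nonadjacent n (parcs D)). \<not> g e"
    using dir by (fastforce simp: edges_of_def nonadjacent_def all_arcs_def)
  ultimately show ?thesis by blast
qed

text \<open>With \<open>v\<close> vertices and \<open>j\<close> arcs in \<open>J\<close>, the
  density bound rearranges to \<open>(j - 1) / m \<le> v - 2\<close>. Compared as exponents of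
  \<open>n\<close>, this is the claim.\<close>

lemma density_condition:
  fixes H :: "'a pair_pre_digraph"
  assumes H: "finite (pverts H)" "parcs H \<subseteq> pverts H \<times> pverts H" "\<forall>(u, v)\<in>parcs H. (v, u) \<notin> parcs H"
    and m: "0 < m2_oriented H" and n: "1 \<le> n" and J: "J \<subseteq> parcs H" "J \<noteq> {}"
  shows "real n ^ (card (pverts H) - card (Field J))
    \<le> (real n powr (- 1 / m2_oriented H)) ^ (card J - 1) * real n ^ card (pverts H) / real n ^ 2"
proof -
  define m where "m = m2_oriented H"
  define h where "h = card (pverts H)"
  define v where "v = card (Field J)"
  define j where "j = card J"
  have FJ: "Field J \<subseteq> pverts H" using J(1) H(2) by (auto simp: Field_def)
  then have finFJ: "finite (Field J)" using H(1) finite_subset by blast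
  have vh: "v \<le> h" unfolding v_def h_def using FJ H(1) by (rule card_mono[rotated])
  have finJ: "finite J" using J(1) H(1,2) by (meson finite_SigmaI finite_subset)
  obtain x y where xy: "(x, y) \<in> J" using J(2) by auto
  have "x \<noteq> y" using xy J(1) H(3) by blast
  have xyF: "{x, y} \<subseteq> Field J" using xy by (auto simp: Field_def)
  then have "card {x, y} \<le> v" unfolding v_def using finFJ by (intro card_mono)
  then have v2: "2 \<le> v" using \<open>x \<noteq> y\<close> by simp
  have j1: "1 \<le> j" unfolding j_def using finJ J(2) by (simp add: Suc_le_eq card_gt_0_iff)
  have n0: "0 < real n" using n by simp
  have key: "(real j - 1) / m \<le> real v - 2"
  proof (cases "3 \<le> v")
    case True
    then have "(real j - 1) / (real v - 2) \<le> m"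
      using rho2_le_m2_oriented[OF H J(1)] by (simp add: v_def j_def m_def)
    then have "real j - 1 \<le> m * (real v - 2)" using True by (simp add: divide_le_eq)
    then show ?thesis using m by (simp add: divide_le_eq m_def mult.commute)
  next
    \<comment> \<open>On two vertices the quotient defining \<open>rho2\<close> does not apply;
      there \<open>J\<close> is a single arc and both sides of \<open>key\<close> are 0.\<close>
    case False
    then have "card (Field J) = card {x, y}" using v2 \<open>x \<noteq> y\<close> by (simp add: v_def)
    then have F: "Field J = {x, y}" using card_subset_eq[OF finFJ xyF] by simp
    have "J \<subseteq> {(x, y)}"
    proof
      fix a assume a: "a \<in> J"
      obtain u w where uw: "a = (u, w)" by fastforce
      have "u \<in> {x, y}" "w \<in> {x, y}" using a F unfolding uw Field_def by blast+
      moreover have "(u, w) \<in> parcs H" "(x, y) \<in> parcs H" using a uw xy J(1) by auto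
      ultimately show "a \<in> {(x, y)}" using H(3) uw by blast
    qed
    then have "J = {(x, y)}" using xy by blast
    then show ?thesis using v2 by (simp add: j_def)
  qed
  have "real n ^ (h - v) = real n powr (real h - real v)"
    using n0 vh by (simp add: powr_realpow[symmetric] of_nat_diff)
  also have "\<dots> \<le> real n powr (- ((real j - 1) / m) + real h - 2)"
    using n key by (intro powr_mono) auto
  also have "\<dots> = real n powr (- ((real j - 1) / m)) * real n powr (real h) / real n powr 2"
    by (simp only: powr_add powr_diff)
  also have "real n powr (- ((real j - 1) / m)) = (real n powr (- 1 / m)) ^ (j - 1)"
    using n0 j1 by (simp add: powr_realpow[symmetric] powr_powr of_nat_diff)
  also have "real n powr (real h) = real n ^ h" using n0 by (rule powr_realpow)
  also have "real n powr 2 = real n ^ 2" using n0 powr_realpow[of "real n" 2] by simp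
  finally show ?thesis by (simp add: h_def v_def j_def m_def)
qed

text \<open>The parameter \<open>x\<close> stays free because it has to be small in terms of
  \<open>c\<close>, which becomes known only here.\<close>

lemma prob_not_arrows_le:
  fixes H :: "'a pair_pre_digraph"
  assumes H: "acyclically_oriented H" and m: "1 / 2 < m2_oriented H"
  shows "\<exists>K c :: real. 0 \<le> K \<and> 0 < c \<and> (\<forall>\<^sub>F n in sequentially. \<forall>p x. 0 \<le> p \<longrightarrow> p \<le> 1 \<longrightarrow> 0 < x \<longrightarrow> x \<le> 1 \<longrightarrow>
    measure_pmf.prob (gnp n p) {G. \<not> arrows G H} \<le>
      exp (K * real n powr (- 1 / m2_oriented H) * real n ^ 2 * ln (1 / x)
        + x * p * real n ^ 2 - p * c * real n ^ 2 / 2))"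
proof -
  define m where "m = m2_oriented H"
  define q where "q n = real n powr (- 1 / m)" for n
  let ?A = "embeddings (pverts H)" and ?r = "arc_image (parcs H)"
  have m0: "0 < m" "1 / 2 < m" using m by (simp_all add: m_def)
  have og: "oriented_graph H" using H by (simp add: acyclically_oriented_def)
  note fin = oriented_graphD(1)[OF og] and sub = oriented_graphD(2)[OF og] and asym = oriented_graphD(3)[OF og]
  have ge1: "\<forall>\<^sub>F n in sequentially. 1 \<le> n" by (rule eventually_ge_at_top)
  have "\<exists>K c :: real. 0 \<le> K \<and> 0 < c \<and> (\<forall>\<^sub>F n in sequentially.
    \<exists>f. container_map (?A n) ?r (all_arcs n) (K * q n * real n ^ 2)
      (\<lambda>C. c * real n ^ 2 \<le> real (card (nonadjacent n C))) f)"
  proof (rule digraph_containers[OF fin acyclic_parcs[OF H] sub])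
    show "q \<longlonglongrightarrow> 0" unfolding q_def
      using m0 by (intro tendsto_neg_powr filterlim_real_sequentially) auto
    show "\<forall>\<^sub>F n in sequentially. 0 < q n" using ge1 by eventually_elim (simp add: q_def)
    show "\<forall>\<^sub>F n in sequentially. 1 \<le> q n * real n ^ 2" using ge1
    proof eventually_elim
      case (elim n)
      \<comment> \<open>\<open>m > 1 / 2\<close> makes the exponent positive.\<close>
      have "1 \<le> real n powr (- 1 / m + 2)" using elim m0 by (intro ge_one_powr_ge_zero) (auto simp: field_simps)
      also have "\<dots> = q n * real n ^ 2" using elim powr_realpow[of "real n" 2] powr_add[of "real n" "- 1 / m" 2] by (simp add: q_def)
      finally show ?case .
    qed
    show "\<forall>\<^sub>F n in sequentially. \<forall>J. J \<subseteq> parcs H \<longrightarrow> J \<noteq> {} \<longrightarrow>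
      real n ^ (card (pverts H) - card (Field J)) \<le> q n ^ (card J - 1) * real n ^ card (pverts H) / real n ^ 2"
      using ge1
    proof eventually_elim
      case (elim n)
      then show ?case using density_condition[OF fin sub asym _ elim] m0(1) by (simp add: q_def m_def)
    qed
  qed
  then obtain K c where K: "0 \<le> K" "0 < c" and ev: "\<forall>\<^sub>F n in sequentially.
    \<exists>f. container_map (?A n) ?r (all_arcs n) (K * q n * real n ^ 2)
      (\<lambda>C. c * real n ^ 2 \<le> real (card (nonadjacent n C))) f"
    by (elim exE conjE)
  from ev have "\<forall>\<^sub>F n in sequentially. \<forall>p x. 0 \<le> p \<longrightarrow> p \<le> 1 \<longrightarrow> 0 < x \<longrightarrow> x \<le> 1 \<longrightarrow>
    measure_pmf.prob (gnp n p) {G. \<not> arrows G H} \<le>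
      exp (K * q n * real n ^ 2 * ln (1 / x) + x * p * real n ^ 2 - p * c * real n ^ 2 / 2)"
  proof eventually_elim
    case (elim n)
    then obtain f where f: "container_map (?A n) ?r (all_arcs n) (K * q n * real n ^ 2)
      (\<lambda>C. c * real n ^ 2 \<le> real (card (nonadjacent n C))) f" by (elim exE)
    show ?case
    proof (intro allI impI)
      fix p x :: real assume px: "0 \<le> p" "p \<le> 1" "0 < x" "x \<le> 1"
      have "measure_pmf.prob (gnp n p) {G. \<not> arrows G H} =
        measure_pmf.prob (Pi_pmf (all_edges n) False (\<lambda>_. bernoulli_pmf p))
          {g. \<not> arrows \<lparr>pverts = {..<n}, parcs = {(u, v). u < n \<and> v < n \<and> u \<noteq> v \<and> g {u, v}}\<rparr> H}"
        by (simp add: gnp_def all_edges_def vimage_def)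
      also have "\<dots> \<le> measure_pmf.prob (Pi_pmf (all_edges n) False (\<lambda>_. bernoulli_pmf p))
         {g. \<exists>I\<in>avoiding (?A n) ?r n. (\<forall>e\<in>edges_of I. g e) \<and> (\<forall>e\<in>edges_of (nonadjacent n I). \<not> g e)}"
        using avoiding_of_not_arrows[OF sub] by (intro measure_pmf.finite_measure_mono) auto
      also have "\<dots> \<le> exp (K * q n * real n ^ 2 * ln (1 / x) + x * p * real n ^ 2 - p * c * real n ^ 2 / 2)"
        by (rule prob_avoiding_le[OF f px])
      finally show "measure_pmf.prob (gnp n p) {G. \<not> arrows G H} \<le>
        exp (K * q n * real n ^ 2 * ln (1 / x) + x * p * real n ^ 2 - p * c * real n ^ 2 / 2)" .
    qed
  qed
  then show ?thesis using K unfolding q_def m_def by blast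
qed

theorem theorem1:
  fixes H :: "'a pair_pre_digraph"
  assumes "acyclically_oriented H"
    and "m2_oriented H > 1 / 2"
  shows "\<exists>C::real. C > 0 \<and>
    (\<forall>p :: nat \<Rightarrow> real.
      (\<forall>n. 0 \<le> p n \<and> p n \<le> 1) \<longrightarrow>
      (\<forall>\<^sub>F n in sequentially. p n \<ge> C * real n powr (- 1 / m2_oriented H)) \<longrightarrow>
      (\<lambda>n. measure_pmf.prob (gnp n (p n)) {G. arrows G H}) \<longlonglongrightarrow> 1)"
proof -
  define m where "m = m2_oriented H"
  define q where "q n = real n powr (- 1 / m)" for n
  have m: "1 / 2 < m" using assms(2) by (simp add: m_def)
  obtain K c where K: "0 \<le> K" "0 < c" and ev: "\<forall>\<^sub>F n in sequentially. \<forall>p x. 0 \<le> p \<longrightarrow> p \<le> 1 \<longrightarrow> 0 < x \<longrightarrow> x \<le> 1 \<longrightarrow>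
    measure_pmf.prob (gnp n p) {G. \<not> arrows G H} \<le>
      exp (K * q n * real n ^ 2 * ln (1 / x) + x * p * real n ^ 2 - p * c * real n ^ 2 / 2)"
    using prob_not_arrows_le[OF assms] unfolding q_def m_def by (elim exE conjE)
  \<comment> \<open>Of the gain \<open>c / 2\<close> in the exponent, an eighth of \<open>c\<close>
    pays for the term with \<open>x\<close> and another, through the choice of \<open>C\<close>, for
    the fingerprints; \<open>c / 4\<close> remains.\<close>
  define x where "x = min 1 (c / 8)"
  have x: "0 < x" "x \<le> 1" "x \<le> c / 8" using K by (auto simp: x_def)
  define L where "L = ln (1 / x)"
  have L: "0 \<le> L" using x by (simp add: L_def)
  \<comment> \<open>Chosen so that \<open>K * L * q n \<le> c / 8 * p n\<close> once
    \<open>C * q n \<le> p n\<close>; the summand 1 keeps \<open>C\<close> positive when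
    \<open>K * L = 0\<close>.\<close>
  define C where "C = 8 * (K * L) / c + 1"
  have KL: "0 \<le> K * L" using K L by simp
  then have C: "0 < C" using K by (simp add: C_def add_nonneg_pos)
  have KLC: "K * L \<le> c / 8 * C" using K by (simp add: C_def field_simps)
  have "(\<lambda>n. measure_pmf.prob (gnp n (p n)) {G. arrows G H}) \<longlonglongrightarrow> 1"
    if p: "\<forall>n. 0 \<le> p n \<and> p n \<le> 1" and pC: "\<forall>\<^sub>F n in sequentially. C * q n \<le> p n" for p :: "nat \<Rightarrow> real"
  proof -
    have bound: "\<forall>\<^sub>F n in sequentially. measure_pmf.prob (gnp n (p n)) {G. \<not> arrows G H}
        \<le> exp (- (c / 4 * C * real n powr (2 - 1 / m)))"
      using ev pC eventually_ge_at_top[of 1]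
    proof eventually_elim
      case (elim n)
      have N: "0 \<le> real n ^ 2" by simp
      have q0: "0 \<le> q n" by (simp add: q_def)
      have "K * q n * real n ^ 2 * L = K * L * (q n * real n ^ 2)" by (simp add: algebra_simps)
      also have "\<dots> \<le> c / 8 * C * (q n * real n ^ 2)" using KLC q0 by (intro mult_right_mono) auto
      also have "\<dots> = c / 8 * (C * q n) * real n ^ 2" by (simp add: algebra_simps)
      also have "\<dots> \<le> c / 8 * p n * real n ^ 2"
        using elim(2) K by (intro mult_right_mono mult_left_mono) auto
      finally have 1: "K * q n * real n ^ 2 * L \<le> c / 8 * p n * real n ^ 2" .
      have 2: "x * p n * real n ^ 2 \<le> c / 8 * p n * real n ^ 2"
        using x(3) p by (intro mult_right_mono) auto
      have "C * q n * real n ^ 2 \<le> p n * real n ^ 2" using elim(2) by (intro mult_right_mono) auto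
      moreover have "q n * real n ^ 2 = real n powr (2 - 1 / m)"
        using elim(3) powr_realpow[of "real n" 2] powr_add[of "real n" "- 1 / m" 2] by (simp add: q_def)
      ultimately have "C * real n powr (2 - 1 / m) \<le> p n * real n ^ 2" by (simp add: mult.assoc)
      then have "c / 4 * (C * real n powr (2 - 1 / m)) \<le> c / 4 * (p n * real n ^ 2)"
        using K by (intro mult_left_mono) auto
      then have "K * q n * real n ^ 2 * L + x * p n * real n ^ 2 - p n * c * real n ^ 2 / 2
          \<le> - (c / 4 * C * real n powr (2 - 1 / m))"
        using 1 2 by (simp add: algebra_simps)
      moreover have "measure_pmf.prob (gnp n (p n)) {G. \<not> arrows G H} \<le>
          exp (K * q n * real n ^ 2 * L + x * p n * real n ^ 2 - p n * c * real n ^ 2 / 2)"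
        using elim(1) p x unfolding L_def by blast
      ultimately show ?case by (meson exp_le_cancel_iff order_trans)
    qed
    have lim: "(\<lambda>n. exp (- (c / 4 * C * real n powr (2 - 1 / m)))) \<longlonglongrightarrow> 0"
    proof -
      have "0 < 2 - 1 / m" using m by (simp add: field_simps)
      then have "(\<lambda>n. real n powr - (2 - 1 / m)) \<longlonglongrightarrow> 0"
        by (intro tendsto_neg_powr filterlim_real_sequentially) (simp only: neg_less_0_iff_less)
      moreover have "\<forall>\<^sub>F n in sequentially. 0 < real n powr - (2 - 1 / m)"
        using eventually_gt_at_top[of 0] by eventually_elim simp
      ultimately have "filterlim (\<lambda>n. inverse (real n powr - (2 - 1 / m))) at_top sequentially"
        by (rule filterlim_inverse_at_top)
      then have "filterlim (\<lambda>n. real n powr (2 - 1 / m)) at_top sequentially"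
        by (simp only: powr_minus inverse_inverse_eq)
      then have "filterlim (\<lambda>n. c / 4 * C * real n powr (2 - 1 / m)) at_top sequentially"
        using K C by (intro filterlim_tendsto_pos_mult_at_top[OF tendsto_const]) auto
      then show ?thesis
        by (intro filterlim_compose[OF exp_at_bot]) (simp add: filterlim_uminus_at_bot)
    qed
    have "(\<lambda>n. measure_pmf.prob (gnp n (p n)) {G. \<not> arrows G H}) \<longlonglongrightarrow> 0"
      by (rule tendsto_sandwich[OF always_eventually bound tendsto_const lim]) simp
    then have "(\<lambda>n. 1 - measure_pmf.prob (gnp n (p n)) {G. \<not> arrows G H}) \<longlonglongrightarrow> 1 - 0"
      by (intro tendsto_diff tendsto_const)
    moreover have "measure_pmf.prob M {G. arrows G H} = 1 - measure_pmf.prob M {G. \<not> arrows G H}"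
      for M :: "nat pair_pre_digraph pmf"
    proof -
      have eq: "{G. arrows G H} = UNIV - {G. \<not> arrows G H}" by auto
      show ?thesis by (subst eq) (use measure_pmf.prob_compl[of "{G. \<not> arrows G H}" M] in simp)
    qed
    ultimately show ?thesis by simp
  qed
  then show ?thesis using C unfolding q_def m_def by blast
qed

end
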